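(* For any $\lambda\in\mathbb C$ with $|\lambda|>1$, the Szlenk index of $F^{(\lambda)}$ is $\omega$, and so $F^{(\lambda)}$ is isomorphic to $c_0$ as a Banach space.
   Context: Scalars are complex; isomorphism of Banach spaces means linear homeomorphism (not necessarily isometric). For $n\ge 0$ let $b(n)$ be the number of ones in the binary expansion of $n$. For $\lambda\in\mathbb C$, $|\lambda|>1$, define $x_0\in\ell_\infty(\mathbb Z)$ by $x_0(n)=\lambda^{-b(n)}$ for $n\ge0$ and $x_0(n)=0$ for $n<0$. With $\sigma(x)(n)=x(n-1)$ the bilateral shift, $F^{(\lambda)}$ is the closed linear span in $\ell_\infty(\mathbb Z)$ of $\{\sigma^m(x_0):m\in\mathbb Z\}$; it is a predual of $\ell_1(\mathbb Z)$, via the isomorphism $\ell_1(\mathbb Z)\to (F^{(\lambda)})^*$, $a\mapsto(x\mapsto\sum_n x(n)a(n))$. Szlenk index: let $E$ be a separable Banach space containing no isomorphic copy of $\ell_1$. For $\varepsilon>0$ set $P_0(\varepsilon)=\{\mu\in E^*:\|\mu\|\le1\}$. Given $P_\alpha(\varepsilon)$ for a countable ordinal $\alpha$, let $P_{\alpha+1}(\varepsilon)$ be the weak$^*$-closure of $$\{\mu\in P_\alpha(\varepsilon):\exists\text{ a sequence }(\mu_n)\subseteq P_\alpha(\varepsilon)\text{ with }\mu_n\to\mu\text{ weak}^*\text{ and }\|\mu_n-\mu\|\ge\varepsilon\ \forall n\}.$$ For a limit ordinal $\alpha$, $P_\alpha(\varepsilon)=\bigcap_{\beta<\alpha}P_\beta(\varepsilon)$.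 Put $\eta(\varepsilon,E)=\sup\{\alpha:P_\alpha(\varepsilon)\neq\emptyset\}$ if this exists (as a countable ordinal), and $\eta(\varepsilon,E)=\omega_1$ otherwise. The Szlenk index of $E$ is $\eta(E)=\sup_{\varepsilon>0}\eta(\varepsilon,E)$. *)

theory Defs
  imports "HOL-Analysis.Analysis"
begin

unbundle cardinal_syntax

section \<open>Ordinals\<close>

text \<open>
  The library type \<open>'a suc\<close> is the field of the successor cardinal of \<open>|UNIV :: 'a set|\<close>;
  we equip it with the underlying well-order.  Then \<open>nat suc\<close> is the set of all countable
  ordinals and \<open>nat suc suc\<close> is the set of all ordinals below \<open>\<omega>\<^sub>2\<close>, in which \<open>\<omega>\<^sub>1\<close> is an
  element like any other.
\<close>

instantiation suc :: (type) wellorder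
begin

definition less_eq_suc :: "'a suc \<Rightarrow> 'a suc \<Rightarrow> bool"
  where "less_eq_suc a b \<longleftrightarrow> (a, b) \<in> card_suc |UNIV :: 'a set|"

definition less_suc :: "'a suc \<Rightarrow> 'a suc \<Rightarrow> bool"
  where "less_suc a b \<longleftrightarrow> a \<le> b \<and> a \<noteq> b"

instance
proof -
  let ?r = "card_suc |UNIV :: 'a set|"
  have wo: "well_order_on UNIV ?r"
    using card_order_card_suc[OF card_of_card_order_on] unfolding card_order_on_def
    by blast
  then have lin: "linear_order_on UNIV ?r" and wf: "wf (?r - Id)"
    unfolding well_order_on_def by blast+
  then have refl: "refl_on UNIV ?r" and tr: "trans ?r" and anti: "antisym ?r"
    and tot: "total_on UNIV ?r"
    unfolding order_on_defs by blast+
  show "OFCLASS('a suc, wellorder_class)"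
  proof
    fix x y z :: "'a suc"
    show "x < y \<longleftrightarrow> x \<le> y \<and> \<not> y \<le> x"
      using anti refl by (auto simp: less_suc_def less_eq_suc_def antisym_def refl_on_def)
    show "x \<le> x"
      using refl by (auto simp: less_eq_suc_def refl_on_def)
    show "x \<le> y \<Longrightarrow> y \<le> z \<Longrightarrow> x \<le> z"
      using tr unfolding less_eq_suc_def trans_def by blast
    show "x \<le> y \<Longrightarrow> y \<le> x \<Longrightarrow> x = y"
      using anti unfolding less_eq_suc_def antisym_def by blast
    show "x \<le> y \<or> y \<le> x"
      using tot refl unfolding less_eq_suc_def total_on_def refl_on_def by (metis UNIV_I)
  next
    fix P :: "'a suc \<Rightarrow> bool" and a
    assume step: "\<And>x. (\<And>y. y < x \<Longrightarrow> P y) \<Longrightarrow> P x"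
    show "P a"
      using wf
    proof (induction a rule: wf_induct_rule)
      case (less x)
      show ?case
        by (rule step) (use less in \<open>auto simp: less_suc_def less_eq_suc_def\<close>)
    qed
  qed
qed

end

type_synonym ordinal = "nat suc suc"

definition ord_zero :: ordinal
  where "ord_zero = (LEAST \<alpha>. True)"

definition ord_succ :: "ordinal \<Rightarrow> ordinal"
  where "ord_succ \<alpha> = (LEAST \<beta>. \<alpha> < \<beta>)"

definition ord_sup :: "ordinal set \<Rightarrow> ordinal"
  where "ord_sup A = (LEAST \<beta>. \<forall>\<alpha>\<in>A. \<alpha> \<le> \<beta>)"

definition ord_omega :: ordinal
  where "ord_omega = (LEAST \<alpha>. infinite {..<\<alpha>})"

definition ord_omega1 :: ordinal
  where "ord_omega1 = (LEAST \<alpha>. uncountable {..<\<alpha>})"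

lemma underS_card_suc: "underS (card_suc |UNIV :: 'a set| ) a = {..<a}"
  by (auto simp: underS_def less_suc_def less_eq_suc_def)

lemma uncountable_nat_suc: "uncountable (UNIV :: nat suc set)"
proof
  assume "countable (UNIV :: nat suc set)"
  then have "|UNIV :: nat suc set| \<le>o |UNIV :: nat set|"
    unfolding countable_def card_of_ordLeq[symmetric] by blast
  moreover have "(card_suc |UNIV :: nat set|, |UNIV :: nat suc set| ) \<in> ordIso"
    using card_of_unique[OF card_order_card_suc[OF card_of_card_order_on]] .
  ultimately have "card_suc |UNIV :: nat set| \<le>o |UNIV :: nat set|"
    using ordIso_ordLeq_trans by blast
  then show False
    using card_suc_greater[OF card_of_card_order_on] not_ordLess_ordLeq by blast
qed

lemma ex_uncountable_ordinal: "\<exists>\<alpha>::ordinal. uncountable {..<\<alpha>}"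
proof -
  let ?R = "card_suc |UNIV :: nat suc set|"
  have co: "Card_order ?R"
    by (rule Card_order_card_suc[OF card_of_card_order_on])
  have less: "|UNIV :: nat suc set| <o ?R"
    by (rule card_suc_greater[OF card_of_card_order_on])
  have wo: "Well_order ?R"
    using co unfolding card_order_on_def by blast
  obtain a where "( |UNIV :: nat suc set|, Restr ?R (underS ?R a)) \<in> ordIso"
    using less ordLess_iff_ordIso_Restr[OF wo card_of_Well_order] by blast
  then have "( |Field |UNIV :: nat suc set| |, |Field (Restr ?R (underS ?R a))| ) \<in> ordIso"
    using card_of_cong by blast
  moreover have "Field (Restr ?R (underS ?R a)) \<subseteq> underS ?R a"
    by (auto simp: Field_def)
  ultimately have "|UNIV :: nat suc set| \<le>o |underS ?R a|"
    by (metis Field_card_of card_of_mono1 ordIso_ordLeq_trans)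
  then obtain f where "inj_on f (UNIV :: nat suc set)" "range f \<subseteq> {..<a}"
    unfolding underS_card_suc card_of_ordLeq[symmetric] by blast
  then have "uncountable {..<a}"
    using uncountable_nat_suc countable_subset countable_image_inj_on by metis
  then show ?thesis ..
qed

lemma uncountable_lessThan_omega1: "uncountable {..<ord_omega1}"
  unfolding ord_omega1_def using ex_uncountable_ordinal by (rule LeastI_ex)

lemma less_omega1_iff: "\<alpha> < ord_omega1 \<longleftrightarrow> countable {..<\<alpha>}"
proof
  show "\<alpha> < ord_omega1 \<Longrightarrow> countable {..<\<alpha>}"
    unfolding ord_omega1_def using not_less_Least by blast
  show "countable {..<\<alpha>} \<Longrightarrow> \<alpha> < ord_omega1"
    using uncountable_lessThan_omega1 countable_subset[of "{..<ord_omega1}" "{..<\<alpha>}"]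
    by (metis lessThan_subset_iff not_le_imp_less)
qed

lemma less_omega_iff: "\<alpha> < ord_omega \<longleftrightarrow> finite {..<\<alpha>}"
proof
  have "infinite {..<ord_omega}"
    unfolding ord_omega_def
    using uncountable_lessThan_omega1 countable_finite by (metis (mono_tags) LeastI)
  then show "finite {..<\<alpha>} \<Longrightarrow> \<alpha> < ord_omega"
    using finite_subset[of "{..<ord_omega}" "{..<\<alpha>}"]
    by (metis lessThan_subset_iff not_le_imp_less)
  show "\<alpha> < ord_omega \<Longrightarrow> finite {..<\<alpha>}"
    unfolding ord_omega_def using not_less_Least by blast
qed

lemma ord_zero_le: "ord_zero \<le> \<alpha>"
  unfolding ord_zero_def by (simp add: Least_le)

lemma ord_succ_greater: "\<alpha> < ord_succ \<alpha>"
proof -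
  let ?R = "card_suc |UNIV :: nat suc set|"
  have co: "Card_order ?R" and F: "Field ?R = UNIV"
    by (rule Card_order_card_suc[OF card_of_card_order_on], rule Field_card_suc)
  have "infinite (Field ?R)"
    unfolding F using ex_uncountable_ordinal
    by (metis countable_finite countable_subset subset_UNIV)
  then have "\<exists>\<beta>. \<alpha> \<noteq> \<beta> \<and> (\<alpha>, \<beta>) \<in> ?R"
    using infinite_Card_order_limit[OF co, of \<alpha>] F by auto
  then have "\<exists>\<beta>. \<alpha> < \<beta>"
    by (auto simp: less_suc_def less_eq_suc_def)
  then show ?thesis
    unfolding ord_succ_def by (rule LeastI_ex)
qed

lemma ord_succ_le_iff: "ord_succ \<alpha> \<le> \<beta> \<longleftrightarrow> \<alpha> < \<beta>"
  using ord_succ_greater[of \<alpha>] Least_le[of "\<lambda>\<beta>. \<alpha> < \<beta>" \<beta>]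
  unfolding ord_succ_def by fastforce

lemma ord_succ_inject: "ord_succ \<alpha> = ord_succ \<beta> \<longleftrightarrow> \<alpha> = \<beta>"
  using ord_succ_le_iff ord_succ_greater by (metis leD linorder_neqE)


unbundle no cardinal_syntax


section \<open>Complex normed spaces\<close>

unbundle bcontfun.lifting

class complex_normed_vector = real_normed_vector +
  fixes scaleC :: "complex \<Rightarrow> 'a \<Rightarrow> 'a"  (infixr \<open>*\<^sub>C\<close> 75)
  assumes scaleC_add_right: "c *\<^sub>C (x + y) = c *\<^sub>C x + c *\<^sub>C y"
    and scaleC_add_left: "(c + d) *\<^sub>C x = c *\<^sub>C x + d *\<^sub>C x"
    and scaleC_scaleC: "c *\<^sub>C d *\<^sub>C x = (c * d) *\<^sub>C x"
    and scaleC_of_real: "of_real r *\<^sub>C x = r *\<^sub>R x"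
    and norm_scaleC: "norm (c *\<^sub>C x) = norm c * norm x"

instantiation complex :: complex_normed_vector
begin

definition scaleC_complex :: "complex \<Rightarrow> complex \<Rightarrow> complex"
  where "scaleC_complex c x = c * x"

instance
  by standard
    (auto simp: scaleC_complex_def algebra_simps norm_mult scaleR_conv_of_real)

end

lemma bounded_linear_scaleC: "bounded_linear (\<lambda>x::'a::complex_normed_vector. c *\<^sub>C x)"
proof (rule bounded_linear_intro[where K = "norm c"])
  fix x y :: 'a and r :: real
  show "c *\<^sub>C (x + y) = c *\<^sub>C x + c *\<^sub>C y"
    by (rule scaleC_add_right)
  show "c *\<^sub>C r *\<^sub>R x = r *\<^sub>R c *\<^sub>C x"
    by (simp add: scaleC_of_real[symmetric] scaleC_scaleC mult.commute)
  show "norm (c *\<^sub>C x) \<le> norm x * norm c"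
    by (simp add: norm_scaleC)
qed

instantiation bcontfun :: (topological_space, complex_normed_vector) complex_normed_vector
begin

lift_definition scaleC_bcontfun :: "complex \<Rightarrow> ('a \<Rightarrow>\<^sub>C 'b) \<Rightarrow> 'a \<Rightarrow>\<^sub>C 'b" is "\<lambda>c f x. c *\<^sub>C f x"
proof -
  fix c and f :: "'a \<Rightarrow> 'b"
  assume "f \<in> bcontfun"
  then have "continuous_on UNIV f" "bounded (range f)"
    by (auto simp: bcontfun_def)
  then have "continuous_on UNIV (\<lambda>x. c *\<^sub>C f x)" "bounded ((\<lambda>y. c *\<^sub>C y) ` range f)"
    using bounded_linear.continuous_on[OF bounded_linear_scaleC]
      bounded_linear_image[OF _ bounded_linear_scaleC] by auto
  then show "(\<lambda>x. c *\<^sub>C f x) \<in> bcontfun"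
    by (simp add: bcontfun_def image_image)
qed

instance
proof
  fix c d :: complex and r :: real and x y :: "'a \<Rightarrow>\<^sub>C 'b"
  show "c *\<^sub>C (x + y) = c *\<^sub>C x + c *\<^sub>C y"
    by transfer (simp add: scaleC_add_right)
  show "(c + d) *\<^sub>C x = c *\<^sub>C x + d *\<^sub>C x"
    by transfer (simp add: scaleC_add_left)
  show "c *\<^sub>C d *\<^sub>C x = (c * d) *\<^sub>C x"
    by transfer (simp add: scaleC_scaleC)
  show "of_real r *\<^sub>C x = r *\<^sub>R x"
    by transfer (simp add: scaleC_of_real)
  have le: "norm (c *\<^sub>C x) \<le> norm c * norm x" for c and x :: "'a \<Rightarrow>\<^sub>C 'b"
  proof (rule norm_bound)
    fix t
    show "norm (apply_bcontfun (c *\<^sub>C x) t) \<le> norm c * norm x"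
      using norm_bounded[of x t]
      by (simp add: scaleC_bcontfun.rep_eq norm_scaleC mult_left_mono)
  qed
  show "norm (c *\<^sub>C x) = norm c * norm x"
  proof (cases "c = 0")
    case True
    then show ?thesis
      using le[of 0 x] by simp
  next
    case False
    have "inverse c *\<^sub>C c *\<^sub>C x = x"
      using False scaleC_of_real[of 1]
      by (intro bcontfun_eqI) (simp add: scaleC_bcontfun.rep_eq scaleC_scaleC)
    then have "norm x \<le> norm (inverse c) * norm (c *\<^sub>C x)"
      using le[of "inverse c" "c *\<^sub>C x"] by simp
    then have "norm c * norm x \<le> norm c * (inverse (norm c) * norm (c *\<^sub>C x))"
      by (intro mult_left_mono) (simp_all only: norm_inverse norm_ge_zero)
    also have "norm c * (inverse (norm c) * norm (c *\<^sub>C x)) = norm (c *\<^sub>C x)"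
      using False by simp
    finally have "norm c * norm x \<le> norm (c *\<^sub>C x)" .
    then show ?thesis
      using le[of c x] by simp
  qed
qed

end

definition clinear_on ::
    "'a::complex_normed_vector set \<Rightarrow> ('a \<Rightarrow> 'b::complex_normed_vector) \<Rightarrow> bool"
  where "clinear_on E f \<longleftrightarrow>
    (\<forall>x\<in>E. \<forall>y\<in>E. f (x + y) = f x + f y) \<and> (\<forall>c. \<forall>x\<in>E. f (c *\<^sub>C x) = c *\<^sub>C f x)"

abbreviation cspan :: "'a::complex_normed_vector set \<Rightarrow> 'a set"
  where "cspan \<equiv> module.span scaleC"

definition isomorphic_spaces ::
    "'a::complex_normed_vector set \<Rightarrow> 'b::complex_normed_vector set \<Rightarrow> bool"
  where "isomorphic_spaces E G \<longleftrightarrow> (\<exists>f g. clinear_on E f \<and> homeomorphism E G f g)"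


section \<open>Dual space and weak-star topology of a subspace\<close>

text \<open>
  A Banach space is given as a closed complex subspace \<open>E\<close> of an ambient type.  Functionals
  on \<open>E\<close> are normalised to be \<open>undefined\<close> off \<open>E\<close>, so that they are points of the library's
  product topology (topology of pointwise convergence) indexed by \<open>E\<close>.
\<close>

definition dual_space :: "'a::complex_normed_vector set \<Rightarrow> ('a \<Rightarrow> complex) set"
  where "dual_space E = {\<mu> \<in> extensional E. clinear_on E \<mu> \<and> continuous_on E \<mu>}"

definition dual_norm :: "'a::complex_normed_vector set \<Rightarrow> ('a \<Rightarrow> complex) \<Rightarrow> real"
  where "dual_norm E \<mu> = (SUP x\<in>{x \<in> E. norm x \<le> 1}. norm (\<mu> x))"

definition weak_star :: "'a::complex_normed_vector set \<Rightarrow> ('a \<Rightarrow> complex) topology"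
  where "weak_star E = subtopology (product_topology (\<lambda>_. euclidean) E) (dual_space E)"


section \<open>The Szlenk index\<close>

text \<open>
  The constructions below are written for an arbitrary subspace; they are used for separable
  spaces not containing \<open>\<ell>\<^sub>1\<close>.  The \<open>P\<^sub>\<alpha>(\<epsilon>)\<close> are also defined for uncountable \<open>\<alpha>\<close>, but only
  those with \<open>\<alpha> < \<omega>\<^sub>1\<close> enter the index.
\<close>

definition szlenk_step ::
    "'a::complex_normed_vector set \<Rightarrow> real \<Rightarrow> ('a \<Rightarrow> complex) set \<Rightarrow> ('a \<Rightarrow> complex) set"
  where "szlenk_step E \<epsilon> P = weak_star E closure_of
    {\<mu> \<in> P. \<exists>\<nu>. (\<forall>n::nat. \<nu> n \<in> P) \<and> limitin (weak_star E) \<nu> \<mu> sequentially \<and>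
      (\<forall>n. dual_norm E (\<lambda>x\<in>E. \<nu> n x - \<mu> x) \<ge> \<epsilon>)}"

function szlenk_set ::
    "'a::complex_normed_vector set \<Rightarrow> real \<Rightarrow> ordinal \<Rightarrow> ('a \<Rightarrow> complex) set"
  where "szlenk_set E \<epsilon> \<alpha> =
    (if \<alpha> = ord_zero then {\<mu> \<in> dual_space E. dual_norm E \<mu> \<le> 1}
     else if \<exists>\<beta>. \<alpha> = ord_succ \<beta> then szlenk_step E \<epsilon> (szlenk_set E \<epsilon> (THE \<beta>. \<alpha> = ord_succ \<beta>))
     else (\<Inter>\<beta>\<in>{..<\<alpha>}. szlenk_set E \<epsilon> \<beta>))"
  by auto
termination
proof (relation "inv_image {(\<beta>, \<alpha>). \<beta> < \<alpha>} (\<lambda>(E, \<epsilon>, \<alpha>). \<alpha>)")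
  show "wf (inv_image {(\<beta>, \<alpha>::ordinal). \<beta> < \<alpha>} (\<lambda>(E, \<epsilon>, \<alpha>). \<alpha>))"
    by (intro wf_inv_image wf)
qed (auto simp: ord_succ_inject ord_succ_greater)

declare szlenk_set.simps [simp del]

lemma szlenk_set_zero:
  "szlenk_set E \<epsilon> ord_zero = {\<mu> \<in> dual_space E. dual_norm E \<mu> \<le> 1}"
  by (subst szlenk_set.simps) simp

lemma szlenk_set_succ:
  "szlenk_set E \<epsilon> (ord_succ \<alpha>) = szlenk_step E \<epsilon> (szlenk_set E \<epsilon> \<alpha>)"
proof -
  have "ord_succ \<alpha> \<noteq> ord_zero"
    using ord_zero_le[of \<alpha>] ord_succ_greater[of \<alpha>] by auto
  then show ?thesis
    by (subst szlenk_set.simps) (auto simp: ord_succ_inject)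
qed

lemma szlenk_set_limit:
  "\<alpha> \<noteq> ord_zero \<Longrightarrow> (\<And>\<beta>. \<alpha> \<noteq> ord_succ \<beta>) \<Longrightarrow>
    szlenk_set E \<epsilon> \<alpha> = (\<Inter>\<beta>\<in>{..<\<alpha>}. szlenk_set E \<epsilon> \<beta>)"
  by (subst szlenk_set.simps) auto

definition szlenk_eta :: "'a::complex_normed_vector set \<Rightarrow> real \<Rightarrow> ordinal"
  where "szlenk_eta E \<epsilon> =
    (let A = {\<alpha>. \<alpha> < ord_omega1 \<and> szlenk_set E \<epsilon> \<alpha> \<noteq> {}}
     in if \<exists>\<beta><ord_omega1. \<forall>\<alpha>\<in>A. \<alpha> \<le> \<beta> then ord_sup A else ord_omega1)"

definition szlenk_index :: "'a::complex_normed_vector set \<Rightarrow> ordinal"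
  where "szlenk_index E = ord_sup {szlenk_eta E \<epsilon> | \<epsilon>. \<epsilon> > 0}"


section \<open>The spaces\<close>

text \<open>
  \<open>int\<close> and \<open>nat\<close> carry the discrete topology, so \<open>int \<Rightarrow>\<^sub>C complex\<close> and
  \<open>nat \<Rightarrow>\<^sub>C complex\<close> are the spaces of all bounded families, with the supremum norm.
\<close>

definition c0_space :: "(nat \<Rightarrow>\<^sub>C complex) set"
  where "c0_space = {x. apply_bcontfun x \<longlonglongrightarrow> 0}"

definition binary_ones :: "nat \<Rightarrow> nat"
  where "binary_ones n = card {k. bit n k}"

text \<open>
  Used only for \<open>norm lam > 1\<close>; then the family is bounded and \<open>Bcontfun\<close> is applied
  within its domain, see \<open>apply_x0\<close> below.
\<close>

definition x0 :: "complex \<Rightarrow> int \<Rightarrow>\<^sub>C complex"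
  where "x0 lam = Bcontfun (\<lambda>n. if n \<ge> 0 then lam powi (- int (binary_ones (nat n))) else 0)"

lemma apply_x0:
  assumes "norm lam > 1"
  shows "apply_bcontfun (x0 lam) n =
    (if n \<ge> 0 then lam powi (- int (binary_ones (nat n))) else 0)"
proof -
  have "norm (lam powi (- int k)) \<le> 1" for k
    using assms one_le_power[of "norm lam" k]
    by (simp add: power_int_minus norm_inverse norm_power inverse_le_1_iff)
  then have "(\<lambda>n. if n \<ge> 0 then lam powi (- int (binary_ones (nat n))) else 0) \<in> bcontfun"
    by (intro bcontfun_normI[where b = 1]) auto
  then show ?thesis
    by (simp add: x0_def Bcontfun_inverse)
qed

lift_definition bshift :: "(int \<Rightarrow>\<^sub>C complex) \<Rightarrow> int \<Rightarrow>\<^sub>C complex" is "\<lambda>x n. x (n - 1)"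
proof -
  fix x :: "int \<Rightarrow> complex"
  assume "x \<in> bcontfun"
  then have "bounded (range x)"
    by (simp add: bcontfun_def)
  then have "bounded (range (\<lambda>n. x (n - 1)))"
    by (rule bounded_subset) auto
  then show "(\<lambda>n. x (n - 1)) \<in> bcontfun"
    by (simp add: bcontfun_def)
qed

definition bshift_power :: "int \<Rightarrow> (int \<Rightarrow>\<^sub>C complex) \<Rightarrow> int \<Rightarrow>\<^sub>C complex"
  where "bshift_power m = (if m \<ge> 0 then bshift ^^ nat m else inv bshift ^^ nat (- m))"

lemma bij_bshift: "bij bshift"
proof (rule bijI)
  show "inj bshift"
  proof (rule injI, rule bcontfun_eqI)
    fix x y n
    assume "bshift x = bshift y"
    then have "apply_bcontfun (bshift x) (n + 1) = apply_bcontfun (bshift y) (n + 1)"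
      by simp
    then show "apply_bcontfun x n = apply_bcontfun y n"
      by (simp add: bshift.rep_eq)
  qed
  show "surj bshift"
  proof (rule surjI)
    fix y :: "int \<Rightarrow>\<^sub>C complex"
    have "bounded (range (apply_bcontfun y))"
      using apply_bcontfun[of y] by (simp add: bcontfun_def)
    then have "bounded (range (\<lambda>n. apply_bcontfun y (n + 1)))"
      by (rule bounded_subset) auto
    then have "(\<lambda>n. apply_bcontfun y (n + 1)) \<in> bcontfun"
      by (simp add: bcontfun_def)
    then show "bshift (Bcontfun (\<lambda>n. apply_bcontfun y (n + 1))) = y"
      by (intro bcontfun_eqI) (simp add: bshift.rep_eq Bcontfun_inverse)
  qed
qed

lemma apply_bshift_power: "apply_bcontfun (bshift_power m x) n = apply_bcontfun x (n - m)"
proof -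
  have pos: "apply_bcontfun ((bshift ^^ k) x) n = apply_bcontfun x (n - int k)" for k n
    by (induction k arbitrary: n) (simp_all add: bshift.rep_eq algebra_simps)
  have inv: "apply_bcontfun (inv bshift y) n = apply_bcontfun y (n + 1)" for y n
  proof -
    have "apply_bcontfun (bshift (inv bshift y)) (n + 1) = apply_bcontfun (inv bshift y) n"
      by (simp add: bshift.rep_eq)
    then show ?thesis
      using bij_bshift by (simp add: bij_is_surj surj_f_inv_f)
  qed
  have neg: "apply_bcontfun ((inv bshift ^^ k) x) n = apply_bcontfun x (n + int k)" for k n
    by (induction k arbitrary: n) (simp_all add: inv algebra_simps)
  show ?thesis
    by (simp add: bshift_power_def pos neg)
qed

definition F_space :: "complex \<Rightarrow> (int \<Rightarrow>\<^sub>C complex) set"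
  where "F_space lam = closure (cspan (range (\<lambda>m. bshift_power m (x0 lam))))"

end

theory Submission
  imports Defs
begin

text \<open>
  Let \<open>x\<^sub>k\<close> be the dilate of \<open>x\<^sub>0\<close> supported on \<open>2\<^sup>k \<nat>\<close>, so that
  \<open>x\<^sub>k = x\<^sub>k\<^sub>+\<^sub>1 + \<lambda>\<^sup>-\<^sup>1 \<sigma>\<^bsup>2^k\<^esup> x\<^sub>k\<^sub>+\<^sub>1\<close>.  Since \<open>|\<lambda>| > 1\<close> this can be inverted by a geometric series,
  and hence all shifts of all \<open>x\<^sub>k\<close> lie in \<open>F\<close>.  The vectors \<open>\<sigma>\<^sup>m x\<^sub>k\<close>, one for each \<open>m \<in> \<int>\<close>, with \<open>k\<close> the
  bit length of \<open>m\<close> if \<open>m \<ge> 0\<close> and \<open>k = -m\<close> if \<open>m < 0\<close>, span a dense subspace, and an explicit operator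
  on \<open>\<ell>\<^sub>\<infinity>(\<int>)\<close> that is bounded and bounded below maps them to the unit vectors.  Therefore they form a
  basis of \<open>F\<close> equivalent to the unit vector basis of \<open>c\<^sub>0\<close>.

  For a space isomorphic to \<open>c\<^sub>0\<close> let \<open>|\<mu>|\<close> be the \<open>\<ell>\<^sub>1\<close> norm of the coordinates of a functional.  If \<open>\<mu>\<^sub>n\<close>
  tends to \<open>\<mu>\<close> weak-star, then \<open>limsup |\<mu>\<^sub>n| = |\<mu>| + limsup |\<mu>\<^sub>n - \<mu>|\<close>, so every Szlenk derivation
  decreases the radius by a fixed multiple of \<open>\<epsilon>\<close> and finitely many of them exhaust the dual ball.
  Conversely, adding small multiples of the weak-star null coordinate functionals shows that a ball of
  radius \<open>1 - k s\<close> survives \<open>k\<close> derivations when \<open>\<epsilon>\<close> is a small enough multiple of \<open>s\<close>.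
\<close>

section \<open>Complex linear maps, \<open>c\<^sub>0\<close> and dual norms\<close>

interpretation complex_vector: vector_space
  "scaleC :: complex \<Rightarrow> 'a \<Rightarrow> 'a::complex_normed_vector"
proof
  fix x :: 'a
  show "1 *\<^sub>C x = x"
    using scaleC_of_real[of 1 x] by simp
qed (simp_all add: scaleC_add_right scaleC_add_left scaleC_scaleC)

lemma apply_bcontfun_scaleC [simp]:
  "apply_bcontfun (c *\<^sub>C x) t = c * apply_bcontfun x t" for x :: "'a::topological_space \<Rightarrow>\<^sub>C complex"
  by (simp add: scaleC_bcontfun.rep_eq scaleC_complex_def)

lemma apply_bcontfun_sum:
  "apply_bcontfun (\<Sum>i\<in>I. x i) t = (\<Sum>i\<in>I. apply_bcontfun (x i) t)"
  for x :: "'i \<Rightarrow> 'a::topological_space \<Rightarrow>\<^sub>C 'b::real_normed_vector"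
  by (induction I rule: infinite_finite_induct) auto

lemma clinear_on_zero:
  assumes "complex_vector.subspace E" "clinear_on E h"
  shows "h 0 = 0"
proof -
  have "h (0 *\<^sub>C 0) = 0 *\<^sub>C h 0"
    using assms complex_vector.subspace_0 unfolding clinear_on_def by blast
  then show ?thesis by simp
qed

lemma clinear_on_diff:
  assumes "complex_vector.subspace E" "clinear_on E h" "x \<in> E" "y \<in> E"
  shows "h (x - y) = h x - h y"
proof -
  have "h (x - y + y) = h (x - y) + h y"
    using assms complex_vector.subspace_diff unfolding clinear_on_def by blast
  then show ?thesis by simp
qed

lemma clinear_on_sum:
  assumes E: "complex_vector.subspace E" "clinear_on E h" and x: "\<And>i. i \<in> I \<Longrightarrow> x i \<in> E"
  shows "h (\<Sum>i\<in>I. c i *\<^sub>C x i) = (\<Sum>i\<in>I. c i *\<^sub>C h (x i))"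
  using x
proof (induction I rule: infinite_finite_induct)
  case (insert i I)
  have "(\<Sum>i\<in>I. c i *\<^sub>C x i) \<in> E" "c i *\<^sub>C x i \<in> E"
    using insert.prems E by (auto intro!: complex_vector.subspace_sum complex_vector.subspace_scale)
  then have "h (c i *\<^sub>C x i + (\<Sum>i\<in>I. c i *\<^sub>C x i)) = h (c i *\<^sub>C x i) + h (\<Sum>i\<in>I. c i *\<^sub>C x i)"
    using E unfolding clinear_on_def by blast
  moreover have "h (c i *\<^sub>C x i) = c i *\<^sub>C h (x i)"
    using E insert.prems unfolding clinear_on_def by blast
  ultimately show ?case
    using insert by simp
qed (simp_all add: clinear_on_zero[OF E])

text \<open>Continuity at 0 gives a radius \<open>d\<close> within which the values have norm below
  1. Rescaling a nonzero \<open>x\<close> to norm \<open>d / 2\<close> then yields the constant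
  \<open>2 / d\<close>.\<close>

lemma clinear_on_bounded:
  assumes E: "complex_vector.subspace E" "clinear_on E h" and "continuous_on E h"
  obtains K where "K > 0" "\<And>x. x \<in> E \<Longrightarrow> norm (h x) \<le> K * norm x"
proof -
  have "0 \<in> E" "h 0 = 0"
    using complex_vector.subspace_0 clinear_on_zero E by auto
  then obtain d where d: "d > 0" "\<And>x. x \<in> E \<Longrightarrow> norm x < d \<Longrightarrow> norm (h x) < 1"
    using \<open>continuous_on E h\<close> unfolding continuous_on_iff by (metis dist_0_norm dist_commute zero_less_one)
  have "norm (h x) \<le> 2 / d * norm x" if x: "x \<in> E" for x
  proof (cases "x = 0")
    case False
    define c where "c = complex_of_real (d / (2 * norm x))"
    have c: "norm c = d / (2 * norm x)"
      using d by (simp add: c_def norm_divide norm_mult)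
    have "c *\<^sub>C x \<in> E" "norm (c *\<^sub>C x) < d"
      using x E d False by (auto simp: norm_scaleC c intro: complex_vector.subspace_scale)
    then have "norm (h (c *\<^sub>C x)) < 1"
      by (rule d)
    moreover have "h (c *\<^sub>C x) = c *\<^sub>C h x"
      using E x unfolding clinear_on_def by blast
    ultimately have "d / (2 * norm x) * norm (h x) < 1"
      by (simp add: norm_scaleC c)
    then show ?thesis
      using d False by (simp add: field_simps)
  qed (simp add: \<open>h 0 = 0\<close>)
  then show thesis
    using that[of "2 / d"] d by simp
qed

section \<open>The space c_0 and its unit vectors\<close>

lemma subspace_c0: "complex_vector.subspace c0_space"
proof -
  have "apply_bcontfun (c *\<^sub>C x) = (\<lambda>t. c * apply_bcontfun x t)" for c and x :: "nat \<Rightarrow>\<^sub>C complex"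
    by auto
  moreover have "apply_bcontfun (x + y) = (\<lambda>t. apply_bcontfun x t + apply_bcontfun y t)"
    for x y :: "nat \<Rightarrow>\<^sub>C complex"
    by auto
  moreover have "apply_bcontfun 0 = (\<lambda>t::nat. 0::complex)"
    by auto
  ultimately show ?thesis
    by (auto simp: complex_vector.subspace_def c0_space_def
        intro: tendsto_add_zero tendsto_mult_right_zero)
qed

definition unit_vec :: "'a::discrete_topology \<Rightarrow> 'a \<Rightarrow>\<^sub>C complex"
  where "unit_vec k = Bcontfun (\<lambda>i. if i = k then 1 else 0)"

lemma apply_unit_vec: "apply_bcontfun (unit_vec k) i = (if i = k then 1 else 0)"
proof -
  have "(\<lambda>i. if i = k then 1 else 0 :: complex) \<in> bcontfun"
    by (intro bcontfun_normI[where b = 1]) (auto simp: continuous_on_discrete)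
  then show ?thesis
    by (simp add: unit_vec_def Bcontfun_inverse)
qed

lemma apply_sum_unit_vec:
  "finite I \<Longrightarrow> apply_bcontfun (\<Sum>k\<in>I. c k *\<^sub>C unit_vec k) i = (if i \<in> I then c i else 0)"
  by (simp add: apply_bcontfun_sum apply_unit_vec if_distrib sum.delta cong: if_cong)

lemma unit_vec_in_c0: "unit_vec k \<in> c0_space"
proof -
  have "\<forall>\<^sub>F i in sequentially. apply_bcontfun (unit_vec k) i = 0"
    using eventually_gt_at_top[of k] by eventually_elim (simp add: apply_unit_vec)
  then show ?thesis
    unfolding c0_space_def by (simp add: tendsto_eventually)
qed

lemma c0_truncation_tendsto:
  assumes "y \<in> c0_space"
  shows "(\<lambda>N. \<Sum>k<N. apply_bcontfun y k *\<^sub>C unit_vec k) \<longlonglongrightarrow> y"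
proof (rule LIMSEQ_I)
  fix r :: real assume "r > 0"
  \<comment> \<open>Half of \<open>r\<close>, since the bound obtained for the supremum norm is not
    strict.\<close>
  then obtain N0 where N0: "\<And>n. n \<ge> N0 \<Longrightarrow> norm (apply_bcontfun y n) < r / 2"
    using assms LIMSEQ_D[of "apply_bcontfun y" 0 "r/2"] unfolding c0_space_def by auto
  have "norm ((\<Sum>k<N. apply_bcontfun y k *\<^sub>C unit_vec k) - y) \<le> r / 2" if "N \<ge> N0" for N
    using N0 that \<open>r > 0\<close> by (intro norm_bound) (auto simp: apply_sum_unit_vec less_imp_le)
  then show "\<exists>no. \<forall>n\<ge>no. norm ((\<Sum>k<n. apply_bcontfun y k *\<^sub>C unit_vec k) - y) < r"
    using \<open>r > 0\<close> by (intro exI[of _ N0]) fastforce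
qed

section \<open>The dual norm and the vector operations of the dual\<close>

lemma dual_norm_le:
  assumes "0 \<in> E" "\<And>x. x \<in> E \<Longrightarrow> norm x \<le> 1 \<Longrightarrow> norm (\<mu> x) \<le> K"
  shows "dual_norm E \<mu> \<le> K"
  unfolding dual_norm_def
proof (rule cSUP_least)
  show "{x \<in> E. norm x \<le> 1} \<noteq> {}"
    using assms(1) by (auto intro: exI[of _ 0])
qed (use assms(2) in auto)

text \<open>The real supremum in \<open>dual_norm\<close> dominates its values only if these are
  bounded above; continuity of \<open>\<mu>\<close> provides such a bound.\<close>

lemma norm_le_dual_norm_unit:
  assumes E: "complex_vector.subspace E" and \<mu>: "\<mu> \<in> dual_space E" and x: "x \<in> E" "norm x \<le> 1"
  shows "norm (\<mu> x) \<le> dual_norm E \<mu>"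
proof -
  have lin: "clinear_on E \<mu>" and cont: "continuous_on E \<mu>"
    using \<mu> by (auto simp: dual_space_def)
  obtain K where K: "K > 0" "\<And>x. x \<in> E \<Longrightarrow> norm (\<mu> x) \<le> K * norm x"
    using clinear_on_bounded[OF E lin cont] by blast
  have bdd: "bdd_above ((\<lambda>x. norm (\<mu> x)) ` {x \<in> E. norm x \<le> 1})"
  proof (rule bdd_aboveI2[where M = K])
    fix y assume y: "y \<in> {x \<in> E. norm x \<le> 1}"
    have "norm (\<mu> y) \<le> K * norm y"
      using y K by auto
    also have "\<dots> \<le> K * 1"
      using y K by (intro mult_left_mono) auto
    finally show "norm (\<mu> y) \<le> K" by simp
  qed
  then show ?thesis
    unfolding dual_norm_def using x by (intro cSUP_upper) auto
qed

lemma dual_norm_nonneg: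
  assumes "complex_vector.subspace E" "\<mu> \<in> dual_space E"
  shows "dual_norm E \<mu> \<ge> 0"
  by (rule order_trans[OF norm_ge_zero norm_le_dual_norm_unit[OF assms, of 0]])
    (use complex_vector.subspace_0[OF assms(1)] in auto)

lemma norm_le_dual_norm:
  assumes E: "complex_vector.subspace E" and \<mu>: "\<mu> \<in> dual_space E" and x: "x \<in> E"
  shows "norm (\<mu> x) \<le> dual_norm E \<mu> * norm x"
proof (cases "x = 0")
  case True
  then show ?thesis
    using clinear_on_zero[OF E, of \<mu>] \<mu> by (simp add: dual_space_def)
next
  case False
  define c where "c = complex_of_real (1 / norm x)"
  have "c *\<^sub>C x \<in> E" "norm (c *\<^sub>C x) = 1"
    using False x complex_vector.subspace_scale[OF E] by (auto simp: c_def norm_scaleC norm_divide)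
  then have "norm (\<mu> (c *\<^sub>C x)) \<le> dual_norm E \<mu>"
    using norm_le_dual_norm_unit[OF E \<mu>] by simp
  moreover have "\<mu> (c *\<^sub>C x) = c *\<^sub>C \<mu> x"
    using \<mu> x unfolding dual_space_def clinear_on_def by blast
  ultimately have "norm (\<mu> x) / norm x \<le> dual_norm E \<mu>"
    by (simp add: c_def norm_scaleC norm_divide)
  then show ?thesis
    using False by (simp add: field_simps)
qed

text \<open>Functionals are extensional, so a sum has to be restricted to \<open>E\<close> again.
  The scalar \<open>c\<close> lets one rule serve differences (\<open>c = -1\<close>) and, with the
  zero functional in place of \<open>\<mu>\<close>, multiples.\<close>

lemma dual_space_add:
  assumes E: "complex_vector.subspace E" and "\<mu> \<in> dual_space E" "\<nu> \<in> dual_space E"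
  shows "(\<lambda>x\<in>E. \<mu> x + c * \<nu> x) \<in> dual_space E"
proof -
  have "clinear_on E (\<lambda>x\<in>E. \<mu> x + c * \<nu> x)"
    using assms complex_vector.subspace_add[OF E] complex_vector.subspace_scale[OF E]
    by (auto simp: dual_space_def clinear_on_def scaleC_complex_def algebra_simps)
  moreover have "continuous_on E (\<lambda>x. \<mu> x + c * \<nu> x)"
    using assms by (auto simp: dual_space_def intro!: continuous_intros)
  then have "continuous_on E (\<lambda>x\<in>E. \<mu> x + c * \<nu> x)"
    by (rule continuous_on_eq) auto
  ultimately show ?thesis
    by (simp add: dual_space_def)
qed

lemma dual_space_zero:
  assumes "complex_vector.subspace E"
  shows "(\<lambda>x\<in>E. 0) \<in> dual_space E"
proof -
  have "continuous_on E (\<lambda>x\<in>E. 0 :: complex)"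
    by (rule continuous_on_eq[of _ "\<lambda>_. 0"]) auto
  then show ?thesis
    using complex_vector.subspace_add[OF assms] complex_vector.subspace_scale[OF assms]
    by (auto simp: dual_space_def clinear_on_def)
qed

section \<open>Weak-star convergence\<close>

lemma topspace_weak_star: "topspace (weak_star E) = dual_space E"
  by (auto simp: weak_star_def topspace_product_topology dual_space_def extensional_def PiE_def)

lemma limitin_weak_star:
  "limitin (weak_star E) \<nu> \<mu> F \<longleftrightarrow>
     \<mu> \<in> dual_space E \<and> (\<forall>\<^sub>F n in F. \<nu> n \<in> dual_space E) \<and> (\<forall>x\<in>E. ((\<lambda>n. \<nu> n x) \<longlongrightarrow> \<mu> x) F)"
proof -
  have "(\<forall>\<^sub>F n in F. \<nu> n \<in> dual_space E) \<Longrightarrow>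
      \<forall>\<^sub>F n in F. \<nu> n \<in> topspace (product_topology (\<lambda>_. euclidean) E)"
    by (erule eventually_mono) (auto simp: dual_space_def topspace_product_topology PiE_def)
  then show ?thesis
    unfolding weak_star_def limitin_subtopology limitin_componentwise
    by (auto simp: dual_space_def)
qed

lemma continuous_map_weak_star: "x \<in> E \<Longrightarrow> continuous_map (weak_star E) euclidean (\<lambda>\<mu>. \<mu> x)"
  unfolding weak_star_def
  by (intro continuous_map_from_subtopology continuous_map_product_projection)

section \<open>Finite ordinals\<close>

definition fin_ord :: "nat \<Rightarrow> ordinal"
  where "fin_ord k = (ord_succ ^^ k) ord_zero"

lemma less_ord_succ_iff: "\<beta> < ord_succ \<alpha> \<longleftrightarrow> \<beta> \<le> \<alpha>"
proof -
  have "\<beta> < ord_succ \<alpha> \<longleftrightarrow> \<not> ord_succ \<alpha> \<le> \<beta>"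
    by (rule not_le[symmetric])
  also have "\<dots> \<longleftrightarrow> \<not> \<alpha> < \<beta>"
    by (simp only: ord_succ_le_iff)
  also have "\<dots> \<longleftrightarrow> \<beta> \<le> \<alpha>"
    by (rule not_less)
  finally show ?thesis .
qed

lemma lessThan_ord_succ: "{..<ord_succ \<alpha>} = insert \<alpha> {..<\<alpha>}"
  by (rule set_eqI) (simp only: lessThan_iff insert_iff less_ord_succ_iff le_less disj_commute)

text \<open>Counting predecessors links \<open>fin_ord\<close> with \<open>ord_omega\<close> and
  \<open>ord_omega1\<close>, which are defined through the size of initial segments.\<close>

lemma lessThan_fin_ord: "finite {..<fin_ord k} \<and> card {..<fin_ord k} = k"
proof (induction k)
  case 0
  have "{..<ord_zero} = {}"
    by (simp add: lessThan_def leD[OF ord_zero_le])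
  then show ?case by (simp add: fin_ord_def)
next
  case (Suc k)
  then show ?case
    by (simp add: fin_ord_def lessThan_ord_succ)
qed

lemma fin_ord_less_omega: "fin_ord k < ord_omega"
  by (simp add: less_omega_iff lessThan_fin_ord)

lemma fin_ord_less_omega1: "fin_ord k < ord_omega1"
  by (simp add: less_omega1_iff countable_finite lessThan_fin_ord)

text \<open>The witness has one predecessor more than \<open>\<beta>\<close>, so its initial segment
  cannot lie inside that of \<open>\<beta>\<close>; linearity turns this into the
  inequality.\<close>

lemma less_omega_imp_less_fin_ord:
  assumes "\<beta> < ord_omega"
  obtains k where "\<beta> < fin_ord k"
proof -
  let ?k = "Suc (card {..<\<beta>})"
  have "finite {..<\<beta>}"
    using assms by (simp add: less_omega_iff)
  then have "\<not> {..<fin_ord ?k} \<subseteq> {..<\<beta>}"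
    using card_mono[of "{..<\<beta>}" "{..<fin_ord ?k}"] lessThan_fin_ord[of ?k] by auto
  then have "\<beta> < fin_ord ?k"
    by (auto simp: lessThan_subset_iff)
  then show thesis ..
qed

section \<open>Reduction of the Szlenk index to its finite stages\<close>

lemma ord_sup_least: "(\<And>\<alpha>. \<alpha> \<in> A \<Longrightarrow> \<alpha> \<le> \<beta>) \<Longrightarrow> ord_sup A \<le> \<beta>"
  unfolding ord_sup_def by (rule Least_le) blast

text \<open>\<open>ord_sup\<close> is a \<open>LEAST\<close>, which is informative only if some
  upper bound exists; \<open>\<beta>\<close> serves as that bound.\<close>

lemma ord_sup_upper:
  assumes "\<alpha> \<in> A" "\<And>\<alpha>. \<alpha> \<in> A \<Longrightarrow> \<alpha> \<le> \<beta>"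
  shows "\<alpha> \<le> ord_sup A"
proof -
  have "\<forall>\<alpha>\<in>A. \<alpha> \<le> ord_sup A"
    unfolding ord_sup_def by (rule LeastI[of _ \<beta>]) (use assms in blast)
  then show ?thesis
    using assms by blast
qed

text \<open>The derived set of the empty set is empty, and a limit stage is contained in every
  earlier one. Hence one empty finite stage bounds \<open>szlenk_eta\<close>.\<close>

lemma szlenk_set_empty_mono:
  assumes "szlenk_set E \<epsilon> \<alpha> = {}" "\<alpha> \<le> \<beta>"
  shows "szlenk_set E \<epsilon> \<beta> = {}"
  using \<open>\<alpha> \<le> \<beta>\<close>
proof (induction \<beta> rule: less_induct)
  case (less \<beta>)
  show ?case
  proof (cases "\<alpha> = \<beta>")
    case False
    then have lt: "\<alpha> < \<beta>"
      using less.prems by simp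
    show ?thesis
    proof (cases "\<exists>\<gamma>. \<beta> = ord_succ \<gamma>")
      case True
      then obtain \<gamma> where \<gamma>: "\<beta> = ord_succ \<gamma>" ..
      have "\<alpha> \<in> insert \<gamma> {..<\<gamma>}" "\<gamma> < \<beta>"
        using lt unfolding \<gamma> lessThan_ord_succ[symmetric] lessThan_iff by (auto intro: ord_succ_greater)
      then have "\<alpha> \<le> \<gamma>"
        by auto
      then have "szlenk_set E \<epsilon> \<gamma> = {}"
        by (rule less.IH[OF \<open>\<gamma> < \<beta>\<close>])
      then show ?thesis
        unfolding \<gamma> szlenk_set_succ szlenk_step_def by simp
    next
      case False
      have "\<beta> \<noteq> ord_zero"
        using lt by (force simp: leD[OF ord_zero_le])
      then have "szlenk_set E \<epsilon> \<beta> = (\<Inter>\<gamma>\<in>{..<\<beta>}. szlenk_set E \<epsilon> \<gamma>)"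
        using False by (intro szlenk_set_limit) blast+
      also have "\<dots> \<subseteq> szlenk_set E \<epsilon> \<alpha>"
        using lt by (intro INT_lower) simp
      finally show ?thesis
        using assms(1) by blast
    qed
  next
    case True
    then show ?thesis
      using assms(1) by simp
  qed
qed

text \<open>A finite bound for each \<open>\<epsilon>\<close>, together with arbitrarily large
  finite values as \<open>\<epsilon>\<close> varies, leaves \<omega> as the only possible
  supremum.\<close>

lemma szlenk_index_eq_omega:
  assumes empty: "\<And>\<epsilon>. \<epsilon> > 0 \<Longrightarrow> \<exists>k. szlenk_set E \<epsilon> (fin_ord k) = {}"
    and nonempty: "\<And>k. \<exists>\<epsilon>>0. szlenk_set E \<epsilon> (fin_ord k) \<noteq> {}"
  shows "szlenk_index E = ord_omega"
proof -
  define A where "A = (\<lambda>\<epsilon>. {\<alpha>. \<alpha> < ord_omega1 \<and> szlenk_set E \<epsilon> \<alpha> \<noteq> {}})"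
  have bound: "\<exists>k. \<forall>\<alpha>\<in>A \<epsilon>. \<alpha> \<le> fin_ord k" if pos: "\<epsilon> > 0" for \<epsilon>
  proof -
    obtain k where "szlenk_set E \<epsilon> (fin_ord k) = {}"
      using empty[OF pos] ..
    then have "\<alpha> \<le> fin_ord k" if "\<alpha> \<in> A \<epsilon>" for \<alpha>
      using szlenk_set_empty_mono[of E \<epsilon> "fin_ord k" \<alpha>] that linear[of \<alpha> "fin_ord k"]
      unfolding A_def by blast
    then have "\<forall>\<alpha>\<in>A \<epsilon>. \<alpha> \<le> fin_ord k"
      by blast
    then show ?thesis ..
  qed
  then have eta: "szlenk_eta E \<epsilon> = ord_sup (A \<epsilon>)" if pos: "\<epsilon> > 0" for \<epsilon>
  proof -
    \<comment> \<open>A finite ordinal is a countable bound, so \<open>szlenk_eta\<close> takes its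
      supremum branch and not the default \<open>ord_omega1\<close>.\<close>
    have "\<exists>\<beta><ord_omega1. \<forall>\<alpha>\<in>A \<epsilon>. \<alpha> \<le> \<beta>"
      using bound[OF pos] fin_ord_less_omega1 by blast
    then show ?thesis
      unfolding szlenk_eta_def Let_def A_def by (rule if_P)
  qed
  have upper: "szlenk_eta E \<epsilon> \<le> ord_omega" if pos: "\<epsilon> > 0" for \<epsilon>
  proof -
    obtain k where "\<forall>\<alpha>\<in>A \<epsilon>. \<alpha> \<le> fin_ord k"
      using bound[OF pos] ..
    then have "ord_sup (A \<epsilon>) \<le> fin_ord k"
      by (intro ord_sup_least) blast
    also have "\<dots> \<le> ord_omega"
      using fin_ord_less_omega by (rule less_imp_le)
    finally show ?thesis
      by (simp only: eta[OF pos])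
  qed
  have lower: "\<exists>\<epsilon>>0. fin_ord k \<le> szlenk_eta E \<epsilon>" for k
  proof -
    obtain \<epsilon> where \<epsilon>: "\<epsilon> > 0" "szlenk_set E \<epsilon> (fin_ord k) \<noteq> {}"
      using nonempty by blast
    then have "fin_ord k \<in> A \<epsilon>"
      by (simp add: A_def fin_ord_less_omega1)
    moreover obtain k' where "\<forall>\<alpha>\<in>A \<epsilon>. \<alpha> \<le> fin_ord k'"
      using bound \<epsilon> by blast
    ultimately have "fin_ord k \<le> ord_sup (A \<epsilon>)"
      by (intro ord_sup_upper[where \<beta> = "fin_ord k'"]) auto
    then show ?thesis
      using \<epsilon>(1) by (intro exI[of _ \<epsilon>]) (simp only: eta)
  qed
  show ?thesis
  proof (rule antisym)
    show "szlenk_index E \<le> ord_omega"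
      unfolding szlenk_index_def by (rule ord_sup_least) (use upper in auto)
    show "ord_omega \<le> szlenk_index E"
    proof (rule ccontr)
      assume "\<not> ord_omega \<le> szlenk_index E"
      then have "szlenk_index E < ord_omega"
        by simp
      then obtain k where k: "szlenk_index E < fin_ord k"
        by (rule less_omega_imp_less_fin_ord)
      obtain \<epsilon> where "\<epsilon> > 0" "fin_ord k \<le> szlenk_eta E \<epsilon>"
        using lower by blast
      moreover have "szlenk_eta E \<epsilon> \<le> szlenk_index E"
        unfolding szlenk_index_def
        by (rule ord_sup_upper[where \<beta> = ord_omega]) (use \<open>\<epsilon> > 0\<close> upper in auto)
      ultimately show False
        using k by simp
    qed
  qed
qed

section \<open>The Szlenk index of a space isomorphic to \<open>c\<^sub>0\<close>\<close>

lemma clinear_on_inverse: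
  assumes E: "complex_vector.subspace E" and f: "clinear_on E f" and hom: "homeomorphism E S f g"
  shows "clinear_on S g"
proof -
  have fg: "g y \<in> E" "f (g y) = y" if "y \<in> S" for y
    using hom that by (auto simp: homeomorphism_def)
  have gf: "g (f x) = x" if "x \<in> E" for x
    using hom that by (auto simp: homeomorphism_def)
  have "g (x + y) = g x + g y" if "x \<in> S" "y \<in> S" for x y
  proof -
    have "f (g x + g y) = x + y"
      using f fg that by (simp add: clinear_on_def)
    then show ?thesis
      using gf[of "g x + g y"] complex_vector.subspace_add[OF E] fg that by simp
  qed
  moreover have "g (c *\<^sub>C x) = c *\<^sub>C g x" if "x \<in> S" for c x
  proof -
    have "f (c *\<^sub>C g x) = c *\<^sub>C x"
      using f fg that by (simp add: clinear_on_def)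
    then show ?thesis
      using gf[of "c *\<^sub>C g x"] complex_vector.subspace_scale[OF E] fg that by simp
  qed
  ultimately show ?thesis
    by (simp add: clinear_on_def)
qed

text \<open>The constants are carried along because the Szlenk sets refer to the given norm of
  \<open>E\<close>, which is only equivalent to that of c_0.\<close>

locale c0_isomorphism =
  fixes E :: "'a::complex_normed_vector set"
    and f :: "'a \<Rightarrow> nat \<Rightarrow>\<^sub>C complex" and g :: "(nat \<Rightarrow>\<^sub>C complex) \<Rightarrow> 'a"
    and A B :: real
  assumes subspace: "complex_vector.subspace E"
    and linear: "clinear_on E f"
    and hom: "homeomorphism E c0_space f g"
    and A_pos: "A > 0" and f_bound: "\<And>x. x \<in> E \<Longrightarrow> norm (f x) \<le> A * norm x"
    and B_pos: "B > 0" and g_bound: "\<And>y. y \<in> c0_space \<Longrightarrow> norm (g y) \<le> B * norm y"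
begin

lemma f_in: "x \<in> E \<Longrightarrow> f x \<in> c0_space" and g_in: "y \<in> c0_space \<Longrightarrow> g y \<in> E"
  and gf: "x \<in> E \<Longrightarrow> g (f x) = x" and fg: "y \<in> c0_space \<Longrightarrow> f (g y) = y"
  using hom unfolding homeomorphism_def by auto

lemma clinear_on_g: "clinear_on c0_space g"
  by (rule clinear_on_inverse[OF subspace linear hom])

definition u :: "nat \<Rightarrow> 'a"
  where "u k = g (unit_vec k)"

lemma u_in: "u k \<in> E"
  by (simp add: u_def g_in unit_vec_in_c0)

lemma f_u: "f (u k) = unit_vec k"
  by (simp add: u_def fg unit_vec_in_c0)

lemma sum_unit_vec_in: "(\<Sum>k\<in>I. c k *\<^sub>C unit_vec k) \<in> c0_space"
  by (intro complex_vector.subspace_sum complex_vector.subspace_scale subspace_c0 unit_vec_in_c0)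

section \<open>Functionals as elements of l_1\<close>

lemma functional_sum:
  assumes "\<mu> \<in> dual_space E"
  shows "\<mu> (g (\<Sum>k\<in>I. c k *\<^sub>C unit_vec k)) = (\<Sum>k\<in>I. c k * \<mu> (u k))"
proof -
  have "g (\<Sum>k\<in>I. c k *\<^sub>C unit_vec k) = (\<Sum>k\<in>I. c k *\<^sub>C u k)"
    unfolding u_def by (rule clinear_on_sum[OF subspace_c0 clinear_on_g unit_vec_in_c0])
  also have "\<mu> \<dots> = (\<Sum>k\<in>I. c k *\<^sub>C \<mu> (u k))"
    using assms by (intro clinear_on_sum[OF subspace] u_in) (simp add: dual_space_def)
  finally show ?thesis
    by (simp add: scaleC_complex_def)
qed

text \<open>Half of the duality between c_0 and l_1: the partial sum is the value of
  \<open>\<mu>\<close> at the image of a finitely supported sequence of phases, whose norm is at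
  most \<open>B\<close>.\<close>

lemma sum_norm_functional_le:
  assumes \<mu>: "\<mu> \<in> dual_space E"
  shows "(\<Sum>k<N. norm (\<mu> (u k))) \<le> B * dual_norm E \<mu>"
proof -
  \<comment> \<open>The conjugate phases turn each term \<open>c k * \<mu> (u k)\<close> into its
    absolute value; since \<open>sgn 0 = 0\<close>, this also holds for vanishing terms.\<close>
  define y where "y = (\<Sum>k<N. cnj (sgn (\<mu> (u k))) *\<^sub>C unit_vec k)"
  have y: "y \<in> c0_space"
    unfolding y_def by (rule sum_unit_vec_in)
  have "norm y \<le> 1"
    unfolding y_def by (intro norm_bound) (auto simp: apply_sum_unit_vec norm_sgn)
  then have "norm (g y) \<le> B"
    using B_pos by (intro order_trans[OF g_bound[OF y] mult_left_le]) auto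
  have "cnj (sgn z) * z = of_real (norm z)" for z :: complex
  proof (cases "z = 0")
    case False
    have "cnj (sgn z) * z = (cnj z * z) / of_real (norm z)"
      by (simp add: sgn_div_norm scaleR_conv_of_real divide_inverse)
    also have "cnj z * z = of_real (norm z) * of_real (norm z)"
      by (simp add: complex_norm_square[symmetric] mult.commute flip: power2_eq_square)
    finally show ?thesis
      using False by simp
  qed simp
  then have "\<mu> (g y) = of_real (\<Sum>k<N. norm (\<mu> (u k)))"
    unfolding y_def functional_sum[OF \<mu>] by simp
  then have "(\<Sum>k<N. norm (\<mu> (u k))) = norm (\<mu> (g y))"
    by (simp only: norm_of_real) (simp add: sum_nonneg)
  also have "\<dots> \<le> dual_norm E \<mu> * norm (g y)"
    by (rule norm_le_dual_norm[OF subspace \<mu> g_in[OF y]])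
  also have "\<dots> \<le> dual_norm E \<mu> * B"
    by (intro mult_left_mono \<open>norm (g y) \<le> B\<close> dual_norm_nonneg[OF subspace \<mu>])
  finally show ?thesis
    by (simp add: mult.commute)
qed

text \<open>The l_1 norm of the coordinates, equivalent to \<open>dual_norm\<close> by the next
  lemmas. It takes over the role of \<open>dual_norm\<close> because it splits into a head and a
  tail.\<close>

definition coord_norm :: "('a \<Rightarrow> complex) \<Rightarrow> real"
  where "coord_norm \<mu> = (\<Sum>k. norm (\<mu> (u k)))"

lemma summable_coord:
  assumes "\<mu> \<in> dual_space E"
  shows "summable (\<lambda>k. norm (\<mu> (u k)))"
  using sum_norm_functional_le[OF assms] by (intro summableI_nonneg_bounded) auto

lemma coord_norm_le:
  assumes "\<mu> \<in> dual_space E"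
  shows "coord_norm \<mu> \<le> B * dual_norm E \<mu>"
  unfolding coord_norm_def
  by (intro suminf_le_const summable_coord assms sum_norm_functional_le)

text \<open>The bound is immediate on truncations of \<open>f x\<close>. These converge to
  \<open>f x\<close> in c_0, and \<open>\<mu>\<close> composed with \<open>g\<close> is
  continuous.\<close>

lemma dual_norm_le_coord_norm:
  assumes \<mu>: "\<mu> \<in> dual_space E"
  shows "dual_norm E \<mu> \<le> A * coord_norm \<mu>"
proof (rule dual_norm_le)
  fix x assume x: "x \<in> E" "norm x \<le> 1"
  let ?s = "\<lambda>N. \<Sum>k<N. apply_bcontfun (f x) k *\<^sub>C unit_vec k"
  have "continuous_on c0_space (\<lambda>y. \<mu> (g y))"
    using hom \<mu> by (auto simp: homeomorphism_def dual_space_def intro: continuous_on_compose2)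
  then have "(\<lambda>N. \<mu> (g (?s N))) \<longlonglongrightarrow> \<mu> (g (f x))"
    by (rule continuous_on_tendsto_compose) (auto intro!: c0_truncation_tendsto f_in x sum_unit_vec_in always_eventually)
  then have lim: "(\<lambda>N. norm (\<mu> (g (?s N)))) \<longlonglongrightarrow> norm (\<mu> x)"
    using x gf tendsto_norm by fastforce
  have "norm (\<mu> (g (?s N))) \<le> A * coord_norm \<mu>" for N
  proof -
    have "norm (\<mu> (g (?s N))) \<le> (\<Sum>k<N. norm (apply_bcontfun (f x) k * \<mu> (u k)))"
      unfolding functional_sum[OF \<mu>] by (rule norm_sum)
    also have "\<dots> \<le> (\<Sum>k<N. A * norm (\<mu> (u k)))"
    proof (rule sum_mono)
      fix k
      have "norm (apply_bcontfun (f x) k) \<le> norm (f x)"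
        by (rule norm_bounded)
      also have "\<dots> \<le> A * norm x"
        by (rule f_bound[OF x(1)])
      also have "\<dots> \<le> A"
        using x A_pos by (simp add: mult_left_le)
      finally show "norm (apply_bcontfun (f x) k * \<mu> (u k)) \<le> A * norm (\<mu> (u k))"
        by (simp add: norm_mult mult_right_mono)
    qed
    also have "\<dots> = A * (\<Sum>k<N. norm (\<mu> (u k)))"
      by (simp add: sum_distrib_left)
    also have "\<dots> \<le> A * coord_norm \<mu>"
      unfolding coord_norm_def using A_pos
      by (intro mult_left_mono sum_le_suminf summable_coord \<mu>) auto
    finally show ?thesis .
  qed
  then show "norm (\<mu> x) \<le> A * coord_norm \<mu>"
    using LIMSEQ_le_const2[OF lim] by blast
qed (use complex_vector.subspace_0[OF subspace] in simp)

section \<open>Upper bound: every derivation shrinks the l_1 radius\<close>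

lemma closedin_coord_norm:
  "closedin (weak_star E) {\<mu> \<in> dual_space E. coord_norm \<mu> \<le> r}"
proof -
  \<comment> \<open>Each partial sum involves finitely many evaluations and is thus weak-star
    continuous, so the ball is an intersection of closed sets.\<close>
  have "{\<mu> \<in> dual_space E. coord_norm \<mu> \<le> r} =
      (\<Inter>N. {\<mu> \<in> topspace (weak_star E). (\<Sum>k<N. norm (\<mu> (u k))) \<in> {..r}})" (is "?L = ?R")
  proof
    show "?L \<subseteq> ?R"
      unfolding coord_norm_def topspace_weak_star
      using sum_le_suminf[OF summable_coord] by (auto intro: order_trans)
    show "?R \<subseteq> ?L"
      unfolding coord_norm_def topspace_weak_star
      by (auto intro!: suminf_le_const summable_coord)
  qed
  moreover have "continuous_map (weak_star E) euclidean (\<lambda>\<mu>. \<Sum>k<N. norm (\<mu> (u k)))" for N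
    by (intro continuous_map_sum continuous_map_norm continuous_map_weak_star u_in) auto
  then have "closedin (weak_star E) {\<mu> \<in> topspace (weak_star E). (\<Sum>k<N. norm (\<mu> (u k))) \<in> {..r}}" for N
    by (rule closedin_continuous_map_preimage) simp
  ultimately show ?thesis
    by (simp only:) (intro closedin_INT, auto)
qed

text \<open>Cut the coordinates at a large \<open>M\<close>. On the head some \<open>\<nu> n\<close>
  is close to \<open>\<mu>\<close>, and the tail of \<open>\<mu>\<close> is small, so the separation
  forces the tail of \<open>\<nu> n\<close> to carry almost \<open>\<epsilon> / A\<close> of its
  mass. That mass is lost in the limit.\<close>

lemma coord_norm_weak_star_limit:
  assumes lim: "limitin (weak_star E) \<nu> \<mu> sequentially"
    and \<nu>: "\<And>n. \<nu> n \<in> dual_space E" "\<And>n. coord_norm (\<nu> n) \<le> r"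
    and sep: "\<And>n. dual_norm E (\<lambda>x\<in>E. \<nu> n x - \<mu> x) \<ge> \<epsilon>"
  shows "coord_norm \<mu> \<le> r - \<epsilon> / A"
proof -
  have \<mu>: "\<mu> \<in> dual_space E" and ptw: "\<And>x. x \<in> E \<Longrightarrow> (\<lambda>n. \<nu> n x) \<longlonglongrightarrow> \<mu> x"
    using lim by (auto simp: limitin_weak_star)
  have sum\<mu>: "summable (\<lambda>k. norm (\<mu> (u k)))"
    by (rule summable_coord[OF \<mu>])
  show ?thesis
  proof (rule field_le_epsilon)
    fix e :: real assume "e > 0"
    \<comment> \<open>A quarter, because the tail of \<open>\<mu>\<close> and the distance of the
      heads each enter twice below.\<close>
    define d where "d = e / 4"
    have "d > 0"
      using \<open>e > 0\<close> by (simp add: d_def)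
    obtain M where M: "(\<Sum>k. norm (\<mu> (u (k + M)))) < d"
      using suminf_exist_split[OF \<open>d > 0\<close> sum\<mu>]
      by (metis abs_ge_self order.refl order_le_less_trans real_norm_def)
    have "(\<lambda>n. \<Sum>k<M. norm (\<nu> n (u k) - \<mu> (u k))) \<longlonglongrightarrow> (\<Sum>k<M. norm (\<mu> (u k) - \<mu> (u k)))"
      by (intro tendsto_intros ptw u_in)
    then have "\<forall>\<^sub>F n in sequentially. (\<Sum>k<M. norm (\<nu> n (u k) - \<mu> (u k))) < d"
      using \<open>d > 0\<close> by (auto dest: order_tendstoD(2))
    then obtain n where n: "(\<Sum>k<M. norm (\<nu> n (u k) - \<mu> (u k))) < d"
      by (auto simp: eventually_sequentially)
    let ?\<delta> = "\<lambda>x\<in>E. \<nu> n x - \<mu> x"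
    have \<delta>: "?\<delta> \<in> dual_space E"
      using dual_space_add[OF subspace \<nu>(1) \<mu>, of n "-1"] by simp
    have sum\<delta>: "summable (\<lambda>k. norm (\<nu> n (u k) - \<mu> (u k)))"
      using summable_coord[OF \<delta>] by (simp add: u_in)
    have sum\<nu>: "summable (\<lambda>k. norm (\<nu> n (u k)))"
      by (rule summable_coord[OF \<nu>(1)])
    have "\<epsilon> \<le> A * coord_norm ?\<delta>"
      using sep[of n] dual_norm_le_coord_norm[OF \<delta>] by simp
    then have "\<epsilon> / A \<le> coord_norm ?\<delta>"
      using A_pos by (simp add: field_simps)
    also have "coord_norm ?\<delta> = (\<Sum>k. norm (\<nu> n (u (k + M)) - \<mu> (u (k + M)))) +
        (\<Sum>k<M. norm (\<nu> n (u k) - \<mu> (u k)))"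
      using suminf_split_initial_segment[OF sum\<delta>, of M] by (simp add: coord_norm_def u_in)
    also have "(\<Sum>k. norm (\<nu> n (u (k + M)) - \<mu> (u (k + M)))) \<le>
        (\<Sum>k. norm (\<nu> n (u (k + M))) + norm (\<mu> (u (k + M))))"
      by (intro suminf_le norm_triangle_ineq4 summable_add summable_ignore_initial_segment
          sum\<delta> sum\<nu> sum\<mu>)
    also have "\<dots> = (\<Sum>k. norm (\<nu> n (u (k + M)))) + (\<Sum>k. norm (\<mu> (u (k + M))))"
      by (intro suminf_add[symmetric] summable_ignore_initial_segment sum\<nu> sum\<mu>)
    finally have tail: "\<epsilon> / A - 2 * d \<le> (\<Sum>k. norm (\<nu> n (u (k + M))))"
      using n M by simp
    have "(\<Sum>k<M. norm (\<mu> (u k))) \<le> (\<Sum>k<M. norm (\<nu> n (u k)) + norm (\<nu> n (u k) - \<mu> (u k)))"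
      by (intro sum_mono) (metis norm_minus_commute norm_triangle_sub)
    also have "\<dots> \<le> (\<Sum>k<M. norm (\<nu> n (u k))) + d"
      using n by (simp add: sum.distrib)
    also have "\<dots> = coord_norm (\<nu> n) - (\<Sum>k. norm (\<nu> n (u (k + M)))) + d"
      using suminf_split_initial_segment[OF sum\<nu>, of M] by (simp add: coord_norm_def)
    also have "\<dots> \<le> r - (\<epsilon> / A - 2 * d) + d"
      using tail \<nu>(2)[of n] by simp
    finally have "coord_norm \<mu> \<le> r - \<epsilon> / A + 4 * d"
      using suminf_split_initial_segment[OF sum\<mu>, of M] M by (simp add: coord_norm_def)
    then show "coord_norm \<mu> \<le> r - \<epsilon> / A + e"
      by (simp add: d_def)
  qed
qed

text \<open>The dual unit ball has \<open>coord_norm\<close> at most \<open>B\<close>, and each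
  derivation costs \<open>\<epsilon> / A\<close>; the closure in \<open>szlenk_step\<close> adds
  nothing more by \<open>closedin_coord_norm\<close>.\<close>

lemma szlenk_set_subset:
  "szlenk_set E \<epsilon> (fin_ord k) \<subseteq> {\<mu> \<in> dual_space E. coord_norm \<mu> \<le> B - real k * (\<epsilon> / A)}"
proof (induction k)
  case 0
  have "coord_norm \<mu> \<le> B" if "\<mu> \<in> dual_space E" "dual_norm E \<mu> \<le> 1" for \<mu>
    using B_pos by (intro order_trans[OF coord_norm_le[OF that(1)] mult_left_le[OF that(2)]]) simp
  then show ?case
    by (auto simp: fin_ord_def szlenk_set_zero)
next
  case (Suc k)
  let ?P = "szlenk_set E \<epsilon> (fin_ord k)"
  have "szlenk_set E \<epsilon> (fin_ord (Suc k)) = szlenk_step E \<epsilon> ?P"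
    by (simp add: fin_ord_def szlenk_set_succ)
  also have "\<dots> \<subseteq> {\<mu> \<in> dual_space E. coord_norm \<mu> \<le> B - real k * (\<epsilon> / A) - \<epsilon> / A}"
    unfolding szlenk_step_def
  proof (intro closure_of_minimal closedin_coord_norm subsetI CollectI)
    fix \<mu>
    assume "\<mu> \<in> {\<mu> \<in> ?P. \<exists>\<nu>. (\<forall>n::nat. \<nu> n \<in> ?P) \<and> limitin (weak_star E) \<nu> \<mu> sequentially \<and>
      (\<forall>n. dual_norm E (\<lambda>x\<in>E. \<nu> n x - \<mu> x) \<ge> \<epsilon>)}"
    then obtain \<nu> where \<nu>: "\<mu> \<in> ?P" "\<And>n::nat. \<nu> n \<in> ?P" "limitin (weak_star E) \<nu> \<mu> sequentially"
      "\<And>n. dual_norm E (\<lambda>x\<in>E. \<nu> n x - \<mu> x) \<ge> \<epsilon>"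
      by blast
    have "coord_norm \<mu> \<le> B - real k * (\<epsilon> / A) - \<epsilon> / A"
      by (rule coord_norm_weak_star_limit[OF \<nu>(3) _ _ \<nu>(4)]) (use Suc.IH \<nu>(2) in blast)+
    then show "\<mu> \<in> dual_space E \<and> coord_norm \<mu> \<le> B - real k * (\<epsilon> / A) - \<epsilon> / A"
      using Suc.IH \<nu>(1) by blast
  qed
  finally show ?case
    by (simp add: algebra_simps)
qed

lemma szlenk_set_eventually_empty:
  assumes "\<epsilon> > 0"
  shows "\<exists>k. szlenk_set E \<epsilon> (fin_ord k) = {}"
proof -
  have "\<epsilon> / A > 0"
    using assms A_pos by simp
  \<comment> \<open>For this \<open>k\<close> the radius in \<open>szlenk_set_subset\<close> is
    negative.\<close>
  then obtain k where k: "B < real k * (\<epsilon> / A)"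
    using reals_Archimedean3 by blast
  have "coord_norm \<mu> \<ge> 0" if "\<mu> \<in> dual_space E" for \<mu>
    unfolding coord_norm_def by (intro suminf_nonneg summable_coord that) simp
  then have "szlenk_set E \<epsilon> (fin_ord k) = {}"
    using szlenk_set_subset[of \<epsilon> k] k by fastforce
  then show ?thesis ..
qed

section \<open>Lower bound: balls that survive the derivations\<close>

definition coord :: "nat \<Rightarrow> 'a \<Rightarrow> complex"
  where "coord k = (\<lambda>x\<in>E. apply_bcontfun (f x) k)"

lemma coord_in_dual: "coord k \<in> dual_space E"
proof -
  have "continuous_on E f"
    using hom by (simp add: homeomorphism_def)
  then have "continuous_on E (\<lambda>x. apply_bcontfun (f x) k)"
    by (auto simp: continuous_on_def intro!: tendsto_uniform_limitI[OF tendsto_bcontfun_uniform_limit])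
  then have "continuous_on E (coord k)"
    unfolding coord_def by (rule continuous_on_eq) auto
  moreover have "clinear_on E (coord k)"
    using linear complex_vector.subspace_add[OF subspace] complex_vector.subspace_scale[OF subspace]
    by (auto simp: clinear_on_def coord_def scaleC_complex_def)
  ultimately show ?thesis
    by (simp add: dual_space_def coord_def)
qed

text \<open>The upper estimate comes from the bound on \<open>f\<close>, the lower one from testing
  at \<open>u k\<close>, where the functional takes the value \<open>s\<close> and whose norm is at
  most \<open>B\<close>.\<close>

lemma dual_norm_scaled_coord:
  assumes "s \<ge> 0"
  shows "dual_norm E (\<lambda>x\<in>E. complex_of_real s * coord k x) \<le> s * A"
    and "s / B \<le> dual_norm E (\<lambda>x\<in>E. complex_of_real s * coord k x)"
proof -
  let ?\<phi> = "\<lambda>x\<in>E. complex_of_real s * coord k x"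
  have \<phi>: "?\<phi> \<in> dual_space E"
    using dual_space_add[OF subspace dual_space_zero[OF subspace] coord_in_dual, of "complex_of_real s" k]
    by (simp cong: restrict_cong)
  show "dual_norm E ?\<phi> \<le> s * A"
  proof (rule dual_norm_le)
    fix x assume x: "x \<in> E" "norm x \<le> 1"
    have "norm (apply_bcontfun (f x) k) \<le> A * norm x"
      using norm_bounded[of "f x" k] f_bound[OF x(1)] by simp
    also have "\<dots> \<le> A"
      using x A_pos by (simp add: mult_left_le)
    finally show "norm (?\<phi> x) \<le> s * A"
      using assms x by (simp add: coord_def norm_mult mult_left_mono)
  qed (use complex_vector.subspace_0[OF subspace] in simp)
  have "norm (unit_vec k) \<le> 1"
    by (rule norm_bound) (simp add: apply_unit_vec)
  then have "norm (u k) \<le> B"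
    unfolding u_def using B_pos
    by (intro order_trans[OF g_bound[OF unit_vec_in_c0] mult_left_le]) auto
  have "s = norm (?\<phi> (u k))"
    using assms by (simp add: u_in coord_def f_u apply_unit_vec)
  also have "\<dots> \<le> dual_norm E ?\<phi> * norm (u k)"
    by (rule norm_le_dual_norm[OF subspace \<phi> u_in])
  also have "\<dots> \<le> dual_norm E ?\<phi> * B"
    by (intro mult_left_mono \<open>norm (u k) \<le> B\<close> dual_norm_nonneg[OF subspace \<phi>])
  finally show "s / B \<le> dual_norm E ?\<phi>"
    using B_pos by (simp add: field_simps)
qed

text \<open>Perturb \<open>\<mu>\<close> by \<open>s * coord n\<close>. The result tends to
  \<open>\<mu>\<close> weak-star because \<open>f x\<close> is a null sequence, stays in the
  previous ball because the norm grows by at most \<open>s * A\<close>, and keeps distance at least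
  \<open>s / B\<close>.\<close>

lemma ball_subset_szlenk_set:
  assumes "s \<ge> 0"
  shows "{\<mu> \<in> dual_space E. dual_norm E \<mu> \<le> 1 - real k * (s * A)} \<subseteq> szlenk_set E (s / B) (fin_ord k)"
proof (induction k)
  case 0
  show ?case
    by (auto simp: fin_ord_def szlenk_set_zero)
next
  case (Suc k)
  let ?P = "szlenk_set E (s / B) (fin_ord k)"
  have eq: "szlenk_set E (s / B) (fin_ord (Suc k)) = szlenk_step E (s / B) ?P"
    by (simp add: fin_ord_def szlenk_set_succ)
  let ?S = "{\<mu> \<in> ?P. \<exists>\<nu>. (\<forall>n::nat. \<nu> n \<in> ?P) \<and> limitin (weak_star E) \<nu> \<mu> sequentially \<and>
      (\<forall>n. dual_norm E (\<lambda>x\<in>E. \<nu> n x - \<mu> x) \<ge> s / B)}"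
  show ?case
  proof (intro subsetI, elim CollectE conjE)
    fix \<mu> assume \<mu>: "\<mu> \<in> dual_space E" and norm_\<mu>: "dual_norm E \<mu> \<le> 1 - real (Suc k) * (s * A)"
    define \<phi> where "\<phi> = (\<lambda>n. \<lambda>x\<in>E. complex_of_real s * coord n x)"
    define \<nu> where "\<nu> = (\<lambda>n. \<lambda>x\<in>E. \<mu> x + complex_of_real s * coord n x)"
    have \<nu>_dual: "\<nu> n \<in> dual_space E" for n
      unfolding \<nu>_def by (rule dual_space_add[OF subspace \<mu> coord_in_dual])
    have "\<mu> \<in> ?P"
      using Suc.IH \<mu> norm_\<mu> mult_nonneg_nonneg[OF assms less_imp_le[OF A_pos]] by (auto simp: algebra_simps)
    moreover have "\<nu> n \<in> ?P" for n
    proof -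
      have \<phi>: "\<phi> n \<in> dual_space E"
        using dual_space_add[OF subspace dual_space_zero[OF subspace] coord_in_dual, of "complex_of_real s" n]
        by (simp add: \<phi>_def cong: restrict_cong)
      have "dual_norm E (\<nu> n) \<le> dual_norm E \<mu> + dual_norm E (\<phi> n)"
      proof (rule dual_norm_le)
        fix x assume x: "x \<in> E" "norm x \<le> 1"
        have "norm (\<nu> n x) \<le> norm (\<mu> x) + norm (\<phi> n x)"
          using x by (simp add: \<nu>_def \<phi>_def norm_triangle_ineq)
        also have "\<dots> \<le> dual_norm E \<mu> + dual_norm E (\<phi> n)"
          using x by (intro add_mono norm_le_dual_norm_unit[OF subspace] \<mu> \<phi>)
        finally show "norm (\<nu> n x) \<le> dual_norm E \<mu> + dual_norm E (\<phi> n)" .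
      qed (use complex_vector.subspace_0[OF subspace] in simp)
      also have "\<dots> \<le> 1 - real k * (s * A)"
        using norm_\<mu> dual_norm_scaled_coord(1)[OF assms, of n] by (simp add: \<phi>_def algebra_simps)
      finally show ?thesis
        using Suc.IH \<nu>_dual by blast
    qed
    moreover have "limitin (weak_star E) \<nu> \<mu> sequentially"
    proof -
      have "(\<lambda>n. \<nu> n x) \<longlonglongrightarrow> \<mu> x" if "x \<in> E" for x
      proof -
        have "apply_bcontfun (f x) \<longlonglongrightarrow> 0"
          using f_in[OF that] by (simp add: c0_space_def)
        then have "(\<lambda>n. \<mu> x + complex_of_real s * apply_bcontfun (f x) n) \<longlonglongrightarrow> \<mu> x + complex_of_real s * 0"
          by (intro tendsto_intros)
        then show ?thesis
          using that by (simp add: \<nu>_def coord_def)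
      qed
      then show ?thesis
        by (simp add: limitin_weak_star \<mu> \<nu>_dual)
    qed
    moreover have "dual_norm E (\<lambda>x\<in>E. \<nu> n x - \<mu> x) \<ge> s / B" for n
    proof -
      have "(\<lambda>x\<in>E. \<nu> n x - \<mu> x) = \<phi> n"
        by (auto simp: \<nu>_def \<phi>_def restrict_def)
      then show ?thesis
        using dual_norm_scaled_coord(2)[OF assms] by (simp add: \<phi>_def)
    qed
    ultimately have "\<mu> \<in> ?S"
      by blast
    \<comment> \<open>A set lies in its \<open>closure_of\<close> only as far as it lies in the
      topological space.\<close>
    moreover have "\<mu> \<in> topspace (weak_star E)"
      using \<mu> by (simp add: topspace_weak_star)
    ultimately show "\<mu> \<in> szlenk_set E (s / B) (fin_ord (Suc k))"
      unfolding eq szlenk_step_def by (metis (no_types, lifting) IntI closure_of_subset_Int subsetD)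
  qed
qed

lemma szlenk_set_nonempty: "\<exists>\<epsilon>>0. szlenk_set E \<epsilon> (fin_ord k) \<noteq> {}"
proof (intro exI conjI)
  \<comment> \<open>Then \<open>k * (s * A) = k / (k + 1) < 1\<close>, so the zero functional
    survives \<open>k\<close> derivations.\<close>
  define s where "s = 1 / (real (Suc k) * A)"
  have s: "s > 0"
    using A_pos by (simp add: s_def)
  show "s / B > 0"
    using s B_pos by simp
  have "dual_norm E (\<lambda>x\<in>E. 0) \<le> 0"
    using complex_vector.subspace_0[OF subspace] by (intro dual_norm_le) auto
  also have "0 \<le> 1 - real k * (s * A)"
    using A_pos by (simp add: s_def divide_simps)
  finally show "szlenk_set E (s / B) (fin_ord k) \<noteq> {}"
    using ball_subset_szlenk_set[of s k] s dual_space_zero[OF subspace] by auto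
qed

end

theorem szlenk_index_c0_isomorphic:
  assumes E: "complex_vector.subspace E" and iso: "isomorphic_spaces E c0_space"
  shows "szlenk_index E = ord_omega"
proof -
  obtain f g where f: "clinear_on E f" and hom: "homeomorphism E c0_space f g"
    using iso by (auto simp: isomorphic_spaces_def)
  have cont: "continuous_on E f" "continuous_on c0_space g"
    using hom by (auto simp: homeomorphism_def)
  obtain A where A: "A > 0" "\<And>x. x \<in> E \<Longrightarrow> norm (f x) \<le> A * norm x"
    using clinear_on_bounded[OF E f cont(1)] by blast
  have g: "clinear_on c0_space g"
    by (rule clinear_on_inverse[OF E f hom])
  obtain B where B: "B > 0" "\<And>y. y \<in> c0_space \<Longrightarrow> norm (g y) \<le> B * norm y"
    using clinear_on_bounded[OF subspace_c0 g cont(2)] by blast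
  interpret c0_isomorphism E f g A B
    using E f hom A B by unfold_locales
  show ?thesis
    using szlenk_index_eq_omega szlenk_set_eventually_empty szlenk_set_nonempty by blast
qed

section \<open>Closed spans isomorphic to \<open>c\<^sub>0\<close>\<close>

lemma subspace_closure:
  fixes S :: "'a::complex_normed_vector set"
  assumes "complex_vector.subspace S"
  shows "complex_vector.subspace (closure S)"
proof (rule complex_vector.subspaceI)
  show "0 \<in> closure S"
    using complex_vector.subspace_0[OF assms] closure_subset by blast
next
  fix x y assume "x \<in> closure S" "y \<in> closure S"
  then obtain xs ys where "\<And>n::nat. xs n \<in> S" "xs \<longlonglongrightarrow> x" "\<And>n::nat. ys n \<in> S" "ys \<longlonglongrightarrow> y"
    unfolding closure_sequential by blast
  then show "x + y \<in> closure S"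
    unfolding closure_sequential
    by (intro exI[of _ "\<lambda>n. xs n + ys n"]) (auto intro: tendsto_add complex_vector.subspace_add[OF assms])
next
  fix c x assume "x \<in> closure S"
  then obtain xs where "\<And>n::nat. xs n \<in> S" "xs \<longlonglongrightarrow> x"
    unfolding closure_sequential by blast
  then show "c *\<^sub>C x \<in> closure S"
    unfolding closure_sequential
    by (intro exI[of _ "\<lambda>n. c *\<^sub>C xs n"])
      (auto intro: bounded_linear.tendsto[OF bounded_linear_scaleC] complex_vector.subspace_scale[OF assms])
qed

text \<open>The geometric series argument: \<open>h 0 = \<Sum>p<P. (- c) ^ p (h p + c h (p + 1)) + (- c) ^ P h P\<close>.\<close>

lemma closed_subspace_geometric:
  fixes h :: "nat \<Rightarrow> 'a::complex_normed_vector"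
  assumes E: "complex_vector.subspace E" "closed E"
    and h: "\<And>p. norm (h p) \<le> C" "\<And>p. h p + c *\<^sub>C h (Suc p) \<in> E" and c: "norm c < 1"
  shows "h 0 \<in> E"
proof -
  let ?r = "\<lambda>P. (- c) ^ P *\<^sub>C h P"
  have "h 0 - ?r P \<in> E" for P
  proof (induction P)
    case 0
    then show ?case
      by (simp add: complex_vector.subspace_0[OF E(1)])
  next
    case (Suc P)
    have "h 0 - ?r (Suc P) = (h 0 - ?r P) + (- c) ^ P *\<^sub>C (h P + c *\<^sub>C h (Suc P))"
      by (simp add: complex_vector.scale_right_distrib mult.commute)
    also have "\<dots> \<in> E"
      by (intro complex_vector.subspace_add complex_vector.subspace_scale E Suc.IH h)
    finally show ?case .
  qed
  then have mem: "\<forall>P. h 0 - ?r P \<in> E" ..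
  have "?r \<longlonglongrightarrow> 0"
  proof (rule Lim_null_comparison)
    show "\<forall>\<^sub>F P in sequentially. norm (?r P) \<le> norm c ^ P * C"
      unfolding norm_scaleC norm_power norm_minus_cancel
      by (intro always_eventually allI mult_left_mono h zero_le_power norm_ge_zero)
    show "(\<lambda>P. norm c ^ P * C) \<longlonglongrightarrow> 0"
      using c by (intro tendsto_mult_left_zero LIMSEQ_power_zero) simp
  qed
  from tendsto_diff[OF tendsto_const[of "h 0"] this]
  have "(\<lambda>P. h 0 - ?r P) \<longlonglongrightarrow> h 0"
    by simp
  then show ?thesis
    by (rule closed_sequentially[OF E(2) spec[OF mem]])
qed

lemma closed_c0_space: "closed c0_space"
  unfolding closed_sequential_limits
proof (intro allI impI, elim conjE)
  fix ys :: "nat \<Rightarrow> nat \<Rightarrow>\<^sub>C complex" and y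
  assume ys: "\<forall>n. ys n \<in> c0_space" "ys \<longlonglongrightarrow> y"
  have "apply_bcontfun y \<longlonglongrightarrow> 0"
  proof (rule LIMSEQ_I)
    fix r :: real assume "r > 0"
    obtain n where n: "dist (ys n) y < r / 2"
      using ys(2) \<open>r > 0\<close> unfolding lim_sequentially by (meson half_gt_zero order_refl)
    have "apply_bcontfun (ys n) \<longlonglongrightarrow> 0"
      using ys(1) by (auto simp: c0_space_def)
    then obtain N where N: "\<And>k. k \<ge> N \<Longrightarrow> norm (apply_bcontfun (ys n) k) < r / 2"
      using LIMSEQ_D[of "apply_bcontfun (ys n)" 0 "r / 2"] \<open>r > 0\<close> by auto
    have "norm (apply_bcontfun y k - 0) < r" if "k \<ge> N" for k
    proof -
      have "dist (apply_bcontfun (ys n) k) (apply_bcontfun y k) < r / 2"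
        using dist_fun_lt_imp_dist_val_lt[OF n] .
      then have "norm (apply_bcontfun y k - apply_bcontfun (ys n) k) < r / 2"
        by (simp add: dist_norm norm_minus_commute)
      then show ?thesis
        using N[OF that] norm_triangle_sub[of "apply_bcontfun y k" "apply_bcontfun (ys n) k"] by simp
    qed
    then show "\<exists>N. \<forall>k\<ge>N. norm (apply_bcontfun y k - 0) < r"
      by blast
  qed
  then show "y \<in> c0_space"
    by (simp add: c0_space_def)
qed

lemma complete_bcontfun: "complete (UNIV :: ('a::topological_space \<Rightarrow>\<^sub>C 'b::complete_space) set)"
proof (rule completeI)
  fix f :: "nat \<Rightarrow> 'a \<Rightarrow>\<^sub>C 'b" assume "Cauchy f"
  then have "uniformly_Cauchy_on UNIV (\<lambda>n. apply_bcontfun (f n))"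
    unfolding Cauchy_def uniformly_Cauchy_on_def by (meson dist_fun_lt_imp_dist_val_lt)
  then obtain l where "uniform_limit UNIV (\<lambda>n. apply_bcontfun (f n)) l sequentially"
    using Cauchy_uniformly_convergent uniformly_convergent_on_def by blast
  then obtain l' where "f \<longlonglongrightarrow> l'"
    by (rule uniform_limit_bcontfunE) simp
  then show "\<exists>l\<in>UNIV. f \<longlonglongrightarrow> l"
    by blast
qed

text \<open>\<open>T\<close> sends combinations of \<open>v\<close> to finitely supported sequences,
  and the upper bound with closedness of c_0 extends this to the closed span. The lower bound gives
  injectivity, makes the preimages of truncations Cauchy, hence surjectivity, and makes the inverse
  continuous.\<close>

lemma isomorphic_c0I:
  fixes T :: "'a::complex_normed_vector \<Rightarrow> nat \<Rightarrow>\<^sub>C complex"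
  assumes complete: "complete (UNIV :: 'a set)"
    and lin: "clinear_on UNIV T"
    and upper: "\<And>x. norm (T x) \<le> C * norm x"
    and lower: "\<And>x. norm x \<le> K * norm (T x)"
    and basis: "\<And>k. T (v k) = unit_vec k"
  shows "isomorphic_spaces (closure (cspan (range v))) c0_space"
proof -
  define E where "E = closure (cspan (range v))"
  have UN: "complex_vector.subspace UNIV"
    by (simp add: complex_vector.subspace_def)
  have diff: "T (x - y) = T x - T y" for x y
    by (rule clinear_on_diff[OF UN lin]) auto
  have add: "T (x + y) = T x + T y" and scale: "T (c *\<^sub>C x) = c *\<^sub>C T x" for x y c
    using lin by (auto simp: clinear_on_def)
  have sum: "T (\<Sum>k<N. c k *\<^sub>C v k) = (\<Sum>k<N. c k *\<^sub>C unit_vec k)" for c N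
    using clinear_on_sum[OF UN lin, of "{..<N}" v c] by (simp add: basis)
  have inj: "x = y" if "T x = T y" for x y
    using lower[of "x - y"] that by (simp add: diff)
  have sub: "complex_vector.subspace E"
    unfolding E_def by (intro subspace_closure complex_vector.subspace_span)
  have "bounded_linear T"
  proof (rule bounded_linear_intro[where K = C])
    show "T (r *\<^sub>R x) = r *\<^sub>R T x" for r x
      by (simp only: scale scaleC_of_real[symmetric])
    show "norm (T x) \<le> norm x * C" for x
      using upper[of x] by (simp add: mult.commute)
  qed (rule add)
  then have cont: "continuous_on A T" for A
    by (rule linear_continuous_on)
  have into: "T x \<in> c0_space" if "x \<in> E" for x
  proof -
    have "T y \<in> c0_space" if "y \<in> cspan (range v)" for y
      using that
    proof (induction rule: complex_vector.span_induct_alt)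
      case base
      then show ?case
        using clinear_on_zero[OF UN lin] complex_vector.subspace_0[OF subspace_c0] by simp
    next
      case (step c x y)
      then show ?case
        by (auto simp: add scale basis intro!: complex_vector.subspace_add complex_vector.subspace_scale
            subspace_c0 unit_vec_in_c0)
    qed
    then have "T ` closure (cspan (range v)) \<subseteq> c0_space"
      by (intro image_closure_subset cont closed_c0_space) auto
    then show ?thesis
      using that by (auto simp: E_def)
  qed
  have onto: "\<exists>x\<in>E. T x = y" if y: "y \<in> c0_space" for y
  proof -
    define w where "w = (\<lambda>N. \<Sum>k<N. apply_bcontfun y k *\<^sub>C v k)"
    have Tw: "(\<lambda>N. T (w N)) \<longlonglongrightarrow> y"
      unfolding w_def sum by (rule c0_truncation_tendsto[OF y])
    have "Cauchy w"
    proof (rule metric_CauchyI)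
      fix e :: real assume "e > 0"
      \<comment> \<open>\<open>K\<close> is not assumed to be positive, so this number replaces it
        as a divisor.\<close>
      have "\<bar>K\<bar> + 1 > 0"
        by simp
      then obtain M where M: "\<And>m n. m \<ge> M \<Longrightarrow> n \<ge> M \<Longrightarrow> dist (T (w m)) (T (w n)) < e / (\<bar>K\<bar> + 1)"
        using metric_CauchyD[OF LIMSEQ_imp_Cauchy[OF Tw], of "e / (\<bar>K\<bar> + 1)"] \<open>e > 0\<close>
        by (metis divide_pos_pos)
      have "dist (w m) (w n) < e" if "m \<ge> M" "n \<ge> M" for m n
      proof -
        have "dist (w m) (w n) \<le> K * dist (T (w m)) (T (w n))"
          using lower[of "w m - w n"] by (simp add: dist_norm diff)
        also have "\<dots> \<le> (\<bar>K\<bar> + 1) * dist (T (w m)) (T (w n))"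
          by (intro mult_right_mono) auto
        also have "\<dots> < e"
          using M[OF that] \<open>\<bar>K\<bar> + 1 > 0\<close> by (simp add: field_simps)
        finally show ?thesis .
      qed
      then show "\<exists>M. \<forall>m\<ge>M. \<forall>n\<ge>M. dist (w m) (w n) < e"
        by blast
    qed
    then obtain x where x: "w \<longlonglongrightarrow> x"
      using complete unfolding complete_def by blast
    have "w N \<in> E" for N
      unfolding w_def E_def
      by (intro subsetD[OF closure_subset] complex_vector.span_sum complex_vector.span_scale
          complex_vector.span_base) auto
    then have "x \<in> E"
      using x closed_sequentially[of E w x] by (auto simp: E_def)
    moreover have "(\<lambda>N. T (w N)) \<longlonglongrightarrow> T x"
      using \<open>bounded_linear T\<close> x by (rule bounded_linear.tendsto)
    then have "T x = y"
      using Tw LIMSEQ_unique by blast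
    ultimately show ?thesis ..
  qed
  define g where "g = inv_into E T"
  have injE: "inj_on T E"
    using inj by (auto intro: inj_onI)
  have img: "T ` E = c0_space"
    using into onto by blast
  have Tg: "T (g y) = y" if "y \<in> c0_space" for y
    using that unfolding g_def img[symmetric] by (rule f_inv_into_f)
  have "continuous_on c0_space g"
  proof (rule continuous_onI)
    fix y e assume y: "y \<in> c0_space" and "e > (0::real)"
    have "dist (g y') (g y) \<le> e" if "y' \<in> c0_space" "dist y' y < e / (\<bar>K\<bar> + 1)" for y'
    proof -
      have "dist (g y') (g y) \<le> K * dist y' y"
        using lower[of "g y' - g y"] by (simp add: dist_norm diff Tg y that)
      also have "\<dots> \<le> (\<bar>K\<bar> + 1) * dist y' y"
        by (intro mult_right_mono) auto
      also have "\<dots> \<le> e"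
        using that by (simp add: field_simps)
      finally show ?thesis .
    qed
    then show "\<exists>d>0. \<forall>y'\<in>c0_space. dist y' y < d \<longrightarrow> dist (g y') (g y) \<le> e"
      using \<open>e > 0\<close> by (intro exI[of _ "e / (\<bar>K\<bar> + 1)"]) auto
  qed
  note cont_g = this
  have "homeomorphism E c0_space T g"
  proof (rule homeomorphismI[OF cont cont_g])
    show "g ` c0_space \<subseteq> E"
      unfolding g_def by (metis image_subsetI img inv_into_into)
    show "g (T x) = x" if "x \<in> E" for x
      unfolding g_def using injE that by (rule inv_into_f_f)
    show "T ` E \<subseteq> c0_space"
      using img by simp
    show "T (g y) = y" if "y \<in> c0_space" for y
      using that by (rule Tg)
  qed
  moreover have "clinear_on E T"
    by (simp add: clinear_on_def add scale)
  ultimately show ?thesis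
    unfolding isomorphic_spaces_def E_def by blast
qed

section \<open>A basis of \<open>F\<close>\<close>

lemma binary_ones_double: "binary_ones (2 * n) = binary_ones n"
proof -
  have "{k. bit (2 * n) k} = Suc ` {k. bit n k}"
  proof (rule set_eqI)
    fix k show "k \<in> {k. bit (2 * n) k} \<longleftrightarrow> k \<in> Suc ` {k. bit n k}"
      by (cases k) (auto simp: bit_Suc bit_0)
  qed
  then show ?thesis
    by (simp add: binary_ones_def card_image)
qed

text \<open>\<open>card\<close> of an infinite set is 0, so inserting the lowest bit is known to
  raise the count only once the set of bits is finite.\<close>

lemma finite_bits: "finite {k. bit n k}" for n :: nat
proof (rule finite_subset)
  show "{k. bit n k} \<subseteq> {..<n}"
  proof
    fix k assume k: "k \<in> {k. bit n k}"
    have "k < 2 ^ k"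
      by (rule less_exp)
    moreover have "\<not> n < 2 ^ k"
      using k by (auto simp: bit_iff_odd)
    ultimately have "k < n"
      by linarith
    then show "k \<in> {..<n}"
      by simp
  qed
qed simp

lemma binary_ones_Suc_double: "binary_ones (Suc (2 * n)) = Suc (binary_ones n)"
proof -
  have "{k. bit (Suc (2 * n)) k} = insert 0 (Suc ` {k. bit n k})"
  proof (rule set_eqI)
    fix k show "k \<in> {k. bit (Suc (2 * n)) k} \<longleftrightarrow> k \<in> insert 0 (Suc ` {k. bit n k})"
      by (cases k) (auto simp: bit_Suc bit_0)
  qed
  then show ?thesis
    by (simp add: binary_ones_def card_image finite_bits)
qed

lemma binary_ones_0 [simp]: "binary_ones 0 = 0"
  by (simp add: binary_ones_def)

text \<open>The new digit sits above all digits of \<open>n\<close>, so nothing is carried. The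
  induction strips the lowest digit of \<open>n\<close>.\<close>

lemma binary_ones_add_power: "n < 2 ^ a \<Longrightarrow> binary_ones (n + 2 ^ a) = Suc (binary_ones n)"
proof (induction a arbitrary: n)
  case 0
  then show ?case
    using binary_ones_Suc_double[of 0] by simp
next
  case (Suc a)
  obtain m r where n: "n = 2 * m + r" "r < 2"
    by (metis mod_less_divisor mult_div_mod_eq zero_less_numeral)
  have IH: "binary_ones (m + 2 ^ a) = Suc (binary_ones m)"
    by (rule Suc.IH) (use Suc.prems n in simp)
  consider "r = 0" | "r = 1"
    using n by linarith
  then show ?case
  proof cases
    case 1
    then have eq: "n + 2 ^ Suc a = 2 * (m + 2 ^ a)" and "n = 2 * m"
      using n by simp_all
    then show ?thesis
      unfolding eq binary_ones_double IH by (simp add: binary_ones_double)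
  next
    case 2
    then have eq: "n + 2 ^ Suc a = Suc (2 * (m + 2 ^ a))" and "n = Suc (2 * m)"
      using n by simp_all
    then show ?thesis
      unfolding eq binary_ones_Suc_double IH by (simp add: binary_ones_Suc_double)
  qed
qed

lemma less_two_power_int: "int j < 2 ^ j"
  by (metis less_exp of_nat_less_numeral_power_cancel_iff)

section \<open>The dilates of x_0 and their self-similarity\<close>

locale F_basis =
  fixes lam :: complex
  assumes norm_lam: "norm lam > 1"
begin

definition q :: complex
  where "q = inverse lam"

lemma norm_q: "norm q < 1"
  using norm_lam by (simp add: q_def norm_inverse inverse_less_1_iff)

text \<open>The values of the dilate x_k: those of x_0, moved to the multiples of
  \<open>2 ^ k\<close>.\<close>

definition dilate_val :: "nat \<Rightarrow> int \<Rightarrow> complex"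
  where "dilate_val k n = (if n \<ge> 0 \<and> 2 ^ k dvd n then q ^ binary_ones (nat (n div 2 ^ k)) else 0)"

lemma dilate_val_mult: "dilate_val k (2 ^ k * int i) = q ^ binary_ones i"
  by (simp add: dilate_val_def)

lemma dilate_val_zero [simp]: "dilate_val k 0 = 1"
  by (simp add: dilate_val_def)

lemma dilate_val_neg: "n < 0 \<Longrightarrow> dilate_val k n = 0"
  by (simp add: dilate_val_def)

lemma dilate_val_not_dvd: "\<not> 2 ^ k dvd n \<Longrightarrow> dilate_val k n = 0"
  by (simp add: dilate_val_def)

lemma dilate_val_between: "0 < n \<Longrightarrow> n < 2 ^ k \<Longrightarrow> dilate_val k n = 0"
  using zdvd_not_zless by (intro dilate_val_not_dvd) blast

lemma norm_dilate_val: "norm (dilate_val k n) \<le> 1"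
  using norm_q by (simp add: dilate_val_def norm_power power_le_one)

text \<open>Adding \<open>2 ^ a\<close> puts one more digit above those of \<open>n\<close>, which
  costs one factor \<open>q\<close>; as \<open>k \<le> a\<close>, divisibility by
  \<open>2 ^ k\<close> is unaffected.\<close>

lemma dilate_val_add_power:
  assumes "k \<le> a" "0 \<le> n" "n < 2 ^ a"
  shows "dilate_val k (n + 2 ^ a) = q * dilate_val k n"
proof (cases "2 ^ k dvd n")
  case True
  then obtain i' where "n = 2 ^ k * i'" ..
  moreover from this have "i' \<ge> 0"
    using assms(2) by (simp add: zero_le_mult_iff)
  ultimately obtain i where i: "n = 2 ^ k * int i"
    using nonneg_int_cases by metis
  have pow: "(2::int) ^ a = 2 ^ k * 2 ^ (a - k)"
    using assms(1) by (simp flip: power_add)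
  have "int i < 2 ^ (a - k)"
    using assms(3) unfolding i pow by simp
  then have "i < 2 ^ (a - k)"
    by (metis of_nat_less_numeral_power_cancel_iff)
  then have "binary_ones (i + 2 ^ (a - k)) = Suc (binary_ones i)"
    by (rule binary_ones_add_power)
  moreover have "n + 2 ^ a = 2 ^ k * int (i + 2 ^ (a - k))"
    unfolding i pow by (simp add: distrib_left)
  ultimately show ?thesis
    by (simp only: i dilate_val_mult power_Suc)
next
  case False
  have "(2::int) ^ k dvd 2 ^ a"
    using assms(1) by (rule le_imp_power_dvd)
  then have "\<not> 2 ^ k dvd n + 2 ^ a"
    using False by (simp add: dvd_add_left_iff)
  then show ?thesis
    using False by (simp add: dilate_val_not_dvd)
qed

lemma dilate_val_add_power_between:
  assumes "k \<le> a" "0 < n" "n < 2 ^ k"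
  shows "dilate_val k (n + 2 ^ a) = 0" "dilate_val k (2 ^ a - n) = 0"
proof -
  have dvd: "(2::int) ^ k dvd 2 ^ a"
    using assms(1) by (rule le_imp_power_dvd)
  have "\<not> 2 ^ k dvd n"
    using assms zdvd_not_zless by blast
  then show "dilate_val k (n + 2 ^ a) = 0" "dilate_val k (2 ^ a - n) = 0"
    using dvd by (auto intro!: dilate_val_not_dvd simp: dvd_add_left_iff dvd_diff_right_iff)
qed

text \<open>Even multiples of \<open>2 ^ k\<close> form the support of the next dilate. Odd ones are
  its shift by \<open>2 ^ k\<close>, and their additional lowest digit gives the factor
  \<open>q\<close>.\<close>

lemma dilate_val_split: "dilate_val k n = dilate_val (Suc k) n + q * dilate_val (Suc k) (n - 2 ^ k)"
proof (cases "n \<ge> 0 \<and> 2 ^ k dvd n")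
  case False
  then have "\<not> 2 ^ k dvd n \<or> n < 0"
    by auto
  then show ?thesis
  proof
    assume n: "\<not> 2 ^ k dvd n"
    then have "\<not> 2 ^ k dvd n - 2 ^ k"
      by (metis dvd_diff_left_iff dvd_refl)
    then show ?thesis
      using n by (metis add_0 dilate_val_not_dvd dvd_mult_left mult_zero_right power_Suc2)
  next
    assume "n < 0"
    moreover from this have "n - 2 ^ k < 0"
      by (smt (verit) zero_less_power)
    ultimately show ?thesis
      by (simp add: dilate_val_neg)
  qed
next
  case True
  then obtain i' where "n = 2 ^ k * i'"
    by blast
  moreover from this have "i' \<ge> 0"
    using True by (simp add: zero_le_mult_iff)
  ultimately obtain i where i: "n = 2 ^ k * int i"
    using nonneg_int_cases by metis
  show ?thesis
  proof (cases "even i")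
    case True
    then obtain m where m: "i = 2 * m" ..
    have n: "n = 2 ^ Suc k * int m"
      by (simp add: i m)
    have "\<not> 2 ^ Suc k dvd n - 2 ^ k"
    proof
      assume "2 ^ Suc k dvd n - 2 ^ k"
      then have "2 ^ k * 2 dvd 2 ^ k * (int i - 1)"
        by (simp add: i algebra_simps)
      then show False
        using True by simp
    qed
    then have "dilate_val (Suc k) (n - 2 ^ k) = 0"
      by (rule dilate_val_not_dvd)
    moreover have "dilate_val k n = q ^ binary_ones i"
      by (simp only: i dilate_val_mult)
    moreover have "dilate_val (Suc k) n = q ^ binary_ones m"
      by (simp only: n dilate_val_mult)
    ultimately show ?thesis
      by (simp add: m binary_ones_double)
  next
    case False
    then obtain m where m: "i = Suc (2 * m)"
      by (auto elim: oddE)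
    have n: "n - 2 ^ k = 2 ^ Suc k * int m"
      by (simp add: i m algebra_simps)
    have "\<not> 2 ^ Suc k dvd n"
    proof
      assume "2 ^ Suc k dvd n"
      then have "2 ^ k * 2 dvd 2 ^ k * int i"
        by (simp add: i algebra_simps)
      then show False
        using False by simp
    qed
    then have "dilate_val (Suc k) n = 0"
      by (rule dilate_val_not_dvd)
    moreover have "dilate_val k n = q ^ binary_ones i"
      by (simp only: i dilate_val_mult)
    moreover have "dilate_val (Suc k) (n - 2 ^ k) = q ^ binary_ones m"
      by (simp only: n dilate_val_mult)
    ultimately show ?thesis
      by (simp add: m binary_ones_Suc_double)
  qed
qed

definition dilate :: "int \<Rightarrow> nat \<Rightarrow> int \<Rightarrow>\<^sub>C complex"
  where "dilate m k = Bcontfun (\<lambda>n. dilate_val k (n - m))"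

lemma apply_dilate: "apply_bcontfun (dilate m k) n = dilate_val k (n - m)"
proof -
  have "(\<lambda>n. dilate_val k (n - m)) \<in> bcontfun"
    using norm_dilate_val by (intro bcontfun_normI[where b = 1]) (auto simp: continuous_on_discrete)
  then show ?thesis
    by (simp add: dilate_def Bcontfun_inverse)
qed

lemma norm_dilate: "norm (dilate m k) \<le> 1"
  by (rule norm_bound) (simp add: apply_dilate norm_dilate_val)

lemma dilate_split: "dilate m k = dilate m (Suc k) + q *\<^sub>C dilate (m + 2 ^ k) (Suc k)"
proof (rule bcontfun_eqI)
  fix n
  show "apply_bcontfun (dilate m k) n =
      apply_bcontfun (dilate m (Suc k) + q *\<^sub>C dilate (m + 2 ^ k) (Suc k)) n"
    using dilate_val_split[of k "n - m"] by (simp add: apply_dilate diff_diff_eq)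
qed

lemma bshift_power_x0: "bshift_power m (x0 lam) = dilate m 0"
  by (rule bcontfun_eqI)
    (simp add: apply_bshift_power apply_x0 norm_lam apply_dilate dilate_val_def q_def
      power_int_minus power_inverse)

text \<open>The bit length of \<open>m\<close> for \<open>m \<ge> 0\<close>.\<close>

definition level :: "int \<Rightarrow> nat"
  where "level m = (if m < 0 then nat (- m) else if m = 0 then 0 else Suc (floor_log (nat m)))"

text \<open>Each \<open>basis m\<close> has value 1 at \<open>m\<close>, its first support point,
  and the choice of \<open>level\<close> makes all its other support points positive.\<close>

definition basis :: "int \<Rightarrow> int \<Rightarrow>\<^sub>C complex"
  where "basis m = dilate m (level m)"

lemma floor_log_int:
  assumes "n > 0"
  shows "2 ^ floor_log (nat n) \<le> n" "n < 2 * 2 ^ floor_log (nat n)"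
proof -
  have "int (2 ^ floor_log (nat n)) \<le> int (nat n)" "int (nat n) < int (2 * 2 ^ floor_log (nat n))"
    using floor_log_exp2_le[of "nat n"] floor_log_exp2_gt[of "nat n"] assms by (simp_all only: of_nat_le_iff of_nat_less_iff)
  then show "2 ^ floor_log (nat n) \<le> n" "n < 2 * 2 ^ floor_log (nat n)"
    using assms by simp_all
qed

lemma level_nonneg:
  assumes "m \<ge> 0"
  shows "m < 2 ^ level m" "a < level m \<Longrightarrow> 2 ^ a \<le> m"
proof -
  show "m < 2 ^ level m"
    using assms floor_log_int[of m] by (auto simp: level_def)
  show "2 ^ a \<le> m" if "a < level m"
  proof -
    have "m > 0" "a \<le> floor_log (nat m)"
      using that assms by (auto simp: level_def split: if_splits)
    then have "(2::int) ^ a \<le> 2 ^ floor_log (nat m)"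
      by (intro power_increasing) auto
    also have "\<dots> \<le> m"
      by (rule floor_log_int[OF \<open>m > 0\<close>])
    finally show ?thesis .
  qed
qed

lemma level_eqI:
  assumes "2 ^ k \<le> m" "m < 2 ^ Suc k"
  shows "level m = Suc k"
proof -
  have "m > 0"
    using assms(1) by (smt (verit) zero_less_power)
  then have nz: "m \<ge> 0" by simp
  have "\<not> level m \<le> k"
  proof
    assume "level m \<le> k"
    then have "(2::int) ^ level m \<le> 2 ^ k"
      by (intro power_increasing) auto
    then show False
      using level_nonneg(1)[OF nz] assms by linarith
  qed
  moreover have "\<not> Suc k < level m"
    using level_nonneg(2)[OF nz, of "Suc k"] assms by linarith
  ultimately show ?thesis by simp
qed

section \<open>The closed span of the basis is F\<close>

definition span_basis :: "(int \<Rightarrow>\<^sub>C complex) set"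
  where "span_basis = cspan (range basis)"

lemma subspace_span_basis: "complex_vector.subspace span_basis"
  unfolding span_basis_def by (rule complex_vector.subspace_span)

lemma basis_in_span: "basis m \<in> span_basis"
  unfolding span_basis_def by (rule complex_vector.span_base) simp

lemma dilate_Suc_eq: "dilate m (Suc k) = dilate m k - q *\<^sub>C dilate (m + 2 ^ k) (Suc k)"
  using dilate_split[of m k] by simp

text \<open>From level \<open>k\<close> to \<open>k + 1\<close> the window gains
  \<open>m = -(k + 1)\<close> and the upper half, where the dilates are basis vectors. The other
  positions follow from level \<open>k\<close> by \<open>dilate_Suc_eq\<close>, the nonnegative ones
  before the negative ones.\<close>

lemma dilate_in_span: "- int k \<le> m \<Longrightarrow> m < 2 ^ k \<Longrightarrow> dilate m k \<in> span_basis"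
proof (induction k arbitrary: m)
  case 0
  then have "m = 0"
    by simp
  then have "dilate m 0 = basis 0"
    by (simp add: basis_def level_def)
  then show ?case
    using basis_in_span by simp
next
  case (Suc k)
  have high: "dilate m (Suc k) \<in> span_basis" if "2 ^ k \<le> m" "m < 2 ^ Suc k" for m
    using basis_in_span[of m] level_eqI[OF that] by (simp add: basis_def)
  have mid: "dilate m (Suc k) \<in> span_basis" if "0 \<le> m" "m < 2 ^ k" for m
    unfolding dilate_Suc_eq[of m]
    by (intro complex_vector.subspace_diff complex_vector.subspace_scale subspace_span_basis Suc.IH high)
      (use that in auto)
  have low: "dilate m (Suc k) \<in> span_basis" if "- int k \<le> m" "m < 0" for m
  proof -
    \<comment> \<open>As \<open>k < 2 ^ k\<close>, the shifted position \<open>m + 2 ^ k\<close>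
      falls into the range already covered by \<open>mid\<close>.\<close>
    have "m < 2 ^ k" "0 \<le> m + 2 ^ k" "m + 2 ^ k < 2 ^ k"
      using that less_two_power_int[of k] by linarith+
    then show ?thesis
      unfolding dilate_Suc_eq[of m]
      by (intro complex_vector.subspace_diff complex_vector.subspace_scale subspace_span_basis
          Suc.IH mid that)
  qed
  consider "2 ^ k \<le> m" | "0 \<le> m" "m < 2 ^ k" | "- int k \<le> m" "m < 0" | "m = - int (Suc k)"
    using Suc.prems by linarith
  then show ?case
  proof cases
    case 4
    then have "level m = Suc k"
      by (simp add: level_def del: of_nat_Suc)
    then show ?thesis
      using basis_in_span[of m] by (simp add: basis_def)
  qed (use high mid low Suc.prems in blast)+
qed

text \<open>Passing to the closure doubles the window to the right, which leaves room for the
  overhang \<open>a\<close> in \<open>dilate_descend\<close>.\<close>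

lemma dilate_in_closure_span:
  assumes "- int k \<le> m" "m < 2 * 2 ^ k"
  shows "dilate m k \<in> closure span_basis"
proof (cases "m < 2 ^ k")
  case True
  then show ?thesis
    using dilate_in_span[OF assms(1)] closure_subset by blast
next
  case False
  define r where "r = m - 2 ^ k"
  have r: "0 \<le> r" "r < 2 ^ k"
    using False assms by (auto simp: r_def)
  \<comment> \<open>With this \<open>h\<close>, \<open>dilate_split\<close> says that
    \<open>h p - q h (p + 1)\<close> is a dilate of level \<open>k + p + 1\<close> at a position
    inside the window of \<open>dilate_in_span\<close>; the geometric series then has ratio
    \<open>q\<close>.\<close>
  define h where "h = (\<lambda>p. dilate (r + 2 ^ (k + p)) (k + p))"
  have "h 0 \<in> closure span_basis"
  proof (rule closed_subspace_geometric)
    show "complex_vector.subspace (closure span_basis)"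
      by (intro subspace_closure subspace_span_basis)
    show "norm (h p) \<le> 1" for p
      by (simp add: h_def norm_dilate)
    show "norm (- q) < 1"
      by (simp add: norm_q)
    show "h p + (- q) *\<^sub>C h (Suc p) \<in> closure span_basis" for p
    proof -
      have "h p + (- q) *\<^sub>C h (Suc p) = dilate (r + 2 ^ (k + p)) (Suc (k + p))"
      proof -
        have "h (Suc p) = dilate (r + 2 ^ (k + p) + 2 ^ (k + p)) (Suc (k + p))"
          by (simp add: h_def add.assoc)
        moreover have "h p = dilate (r + 2 ^ (k + p)) (k + p)"
          by (simp only: h_def)
        ultimately show ?thesis
          using dilate_split[of "r + 2 ^ (k + p)" "k + p"] by simp
      qed
      also have "\<dots> \<in> span_basis"
      proof (rule dilate_in_span)
        have "(2::int) ^ k \<le> 2 ^ (k + p)"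
          by (intro power_increasing) auto
        then show "- int (Suc (k + p)) \<le> r + 2 ^ (k + p)" "r + 2 ^ (k + p) < 2 ^ Suc (k + p)"
          using r unfolding power_Suc by linarith+
      qed
      finally show ?thesis
        using closure_subset by blast
    qed
  qed simp
  then show ?thesis
    by (simp add: h_def r_def)
qed

text \<open>A dilate of level \<open>l\<close> is built from two of level \<open>l + 1\<close>, one
  of them shifted by \<open>2 ^ l\<close>. The right end of the window grows by exactly
  \<open>2 ^ l\<close> as well, so the overhang \<open>a\<close> stays fixed.\<close>

lemma dilate_descend:
  assumes E: "complex_vector.subspace E"
    and top: "\<And>m. - a \<le> m \<Longrightarrow> m \<le> 2 ^ (l + p) + a \<Longrightarrow> dilate m (l + p) \<in> E"
    and m: "- a \<le> m" "m \<le> 2 ^ l + a"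
  shows "dilate m l \<in> E"
  using top m
proof (induction p arbitrary: m l)
  case (Suc p)
  have IH: "dilate m (Suc l) \<in> E" if "- a \<le> m" "m \<le> 2 ^ Suc l + a" for m
    by (rule Suc.IH) (use Suc.prems(1) that in auto)
  have pos: "(2::int) ^ l > 0"
    by simp
  have "m \<le> 2 ^ Suc l + a" "- a \<le> m + 2 ^ l" "m + 2 ^ l \<le> 2 ^ Suc l + a"
    unfolding power_Suc using Suc.prems(2,3) pos by linarith+
  then show ?case
    unfolding dilate_split[of m l]
    by (intro complex_vector.subspace_add complex_vector.subspace_scale E IH Suc.prems(2))
qed simp

lemma F_space_eq: "F_space lam = closure span_basis"
proof
  let ?G = "range (\<lambda>m. bshift_power m (x0 lam))"
  have sub: "complex_vector.subspace (closure span_basis)"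
    by (intro subspace_closure subspace_span_basis)
  have "dilate m 0 \<in> closure span_basis" for m
  proof -
    \<comment> \<open>Descend from level \<open>k = \<bar>m\<bar>\<close> with overhang
      \<open>k\<close>: since \<open>k < 2 ^ k\<close>, the window at the top lies inside the
      doubled one.\<close>
    obtain k where k: "\<bar>m\<bar> = int k"
      by (metis abs_ge_zero nonneg_int_cases)
    show ?thesis
    proof (rule dilate_descend[OF sub, of "int k" 0 k])
      show "dilate m' (0 + k) \<in> closure span_basis"
        if "- int k \<le> m'" "m' \<le> 2 ^ (0 + k) + int k" for m'
      proof -
        have "m' < 2 * 2 ^ k"
          using that(2) less_two_power_int[of k] unfolding add_0 by linarith
        then show ?thesis
          unfolding add_0 using that(1) by (intro dilate_in_closure_span)
      qed
    qed (use k in auto)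
  qed
  then have "cspan ?G \<subseteq> closure span_basis"
    by (intro complex_vector.span_minimal sub) (auto simp: bshift_power_x0)
  then show "F_space lam \<subseteq> closure span_basis"
    unfolding F_space_def by (intro closure_minimal) auto
next
  have sub: "complex_vector.subspace (F_space lam)"
    unfolding F_space_def by (intro subspace_closure complex_vector.subspace_span)
  have "dilate m k \<in> F_space lam" for m k
  proof (induction k arbitrary: m)
    case 0
    have "dilate m 0 \<in> cspan (range (\<lambda>m. bshift_power m (x0 lam)))"
      by (rule complex_vector.span_base) (auto simp: bshift_power_x0)
    then show ?case
      unfolding F_space_def using closure_subset by blast
  next
    case (Suc k)
    \<comment> \<open>Here \<open>h p + q h (p + 1)\<close> is the dilate of level \<open>k\<close>
      at \<open>m + p * 2 ^ k\<close>, available by induction for every position, so the series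
      recovers level \<open>k + 1\<close>.\<close>
    define h where "h = (\<lambda>p. dilate (m + int p * 2 ^ k) (Suc k))"
    have "h 0 \<in> F_space lam"
    proof (rule closed_subspace_geometric[OF sub])
      show "closed (F_space lam)"
        by (simp add: F_space_def)
      show "norm (h p) \<le> 1" for p
        by (simp add: h_def norm_dilate)
      show "h p + q *\<^sub>C h (Suc p) \<in> F_space lam" for p
        using Suc.IH[of "m + int p * 2 ^ k"] dilate_split[of "m + int p * 2 ^ k" k]
        by (simp add: h_def algebra_simps)
    qed (rule norm_q)
    then show ?case
      by (simp add: h_def)
  qed
  then have "span_basis \<subseteq> F_space lam"
    unfolding span_basis_def by (intro complex_vector.span_minimal sub) (auto simp: basis_def)
  then show "closure span_basis \<subseteq> F_space lam"
    by (intro closure_minimal) (simp_all add: F_space_def)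
qed

section \<open>Biorthogonality of the coordinate functionals\<close>

text \<open>For \<open>n = 2 * 2 ^ a - j\<close> this is what the first correction leaves of
  \<open>basis (- j)\<close> at \<open>n\<close>. That vector is \<open>q\<close> at
  \<open>n\<close> if \<open>j \<le> a + 1\<close>, and \<open>q\<close> at \<open>n - 2 ^ a\<close>
  if \<open>j \<le> a\<close>; otherwise these values are 0.\<close>

definition corr :: "int \<Rightarrow> complex"
  where "corr n = (let a = floor_log (nat n); j = 2 * 2 ^ a - n in
    if j \<le> int a then q - q\<^sup>2 else if j = int a + 1 then q else 0)"

text \<open>
  The coordinate functionals biorthogonal to \<^term>\<open>basis\<close>.  For \<open>n = 2\<^sup>a + r\<close> with \<open>0 \<le> r < 2\<^sup>a\<close> the first
  correction \<open>q x(r)\<close> annihilates the basis vectors with \<open>m \<ge> 0\<close> at \<open>n \<noteq> m\<close>.  What remains of the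
  vector with \<open>m = - j\<close> sits at the points \<open>2\<^sup>s - j\<close> with \<open>s \<ge> j\<close>; these are distinct for distinct pairs
  \<open>(s, j)\<close>, so that one further correction removes it.
\<close>

definition coord_val :: "(int \<Rightarrow> complex) \<Rightarrow> int \<Rightarrow> complex"
  where "coord_val x n = (if n \<le> 0 then x n else let a = floor_log (nat n) in
    x n - q * x (n - 2 ^ a) - corr n * x (n - 2 * 2 ^ a))"

text \<open>If \<open>level m \<le> a\<close>, moving from \<open>n - 2 ^ a\<close> to
  \<open>n\<close> adds a digit or both values vanish, so the first correction cancels. If
  \<open>level m > a\<close>, then \<open>n\<close> lies below the second support point and only
  \<open>n = m\<close> remains.\<close>

lemma coord_val_basis_nonneg:
  assumes "m \<ge> 0"
  shows "coord_val (\<lambda>n. dilate_val (level m) (n - m)) n = (if n = m then 1 else 0)"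
proof (cases "n > 0")
  case False
  then show ?thesis
    using assms by (auto simp: coord_val_def dilate_val_neg)
next
  case True
  define a where "a = floor_log (nat n)"
  define r where "r = n - 2 ^ a"
  have a: "2 ^ a \<le> n" "n < 2 * 2 ^ a"
    unfolding a_def using floor_log_int[OF True] by auto
  \<comment> \<open>The second correction evaluates at a negative point, where a vector with
    \<open>m \<ge> 0\<close> vanishes.\<close>
  have coord_val: "coord_val (\<lambda>n. dilate_val (level m) (n - m)) n =
      dilate_val (level m) (n - m) - q * dilate_val (level m) (r - m)"
    using True a assms by (simp add: coord_val_def Let_def a_def[symmetric] r_def dilate_val_neg)
  show ?thesis
  proof (cases "level m \<le> a")
    case le: True
    have "(2::int) ^ level m \<le> 2 ^ a"
      using le by (intro power_increasing) auto
    then have "m < 2 ^ a"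
      using level_nonneg(1)[OF assms] by linarith
    then have "n \<noteq> m"
      using a by linarith
    have "dilate_val (level m) (n - m) = q * dilate_val (level m) (r - m)"
    proof (cases "r \<ge> m")
      case True
      then show ?thesis
        using dilate_val_add_power[OF le, of "r - m"] a assms by (simp add: r_def)
    next
      case False
      have "m - r < 2 ^ level m"
        using level_nonneg(1)[OF assms] a by (simp add: r_def)
      then show ?thesis
        using dilate_val_add_power_between(2)[OF le, of "m - r"] False
        by (simp add: r_def dilate_val_neg)
    qed
    then show ?thesis
      using \<open>n \<noteq> m\<close> by (simp add: coord_val)
  next
    case False
    then have m: "2 ^ a \<le> m"
      using level_nonneg(2)[OF assms] by simp
    have "(2::int) ^ a \<le> 2 ^ level m"
      using False by (intro power_increasing) auto
    then have "n - m < 2 ^ level m"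
      using a m by linarith
    moreover have "r < m"
      using a m by (simp add: r_def)
    ultimately show ?thesis
      unfolding coord_val
      using dilate_val_between[of "n - m" "level m"] dilate_val_neg[of "n - m" "level m"]
        dilate_val_neg[of "r - m" "level m"] by (cases n m rule: linorder_cases) auto
  qed
qed

text \<open>The second correction probes the vector at its first support point exactly when
  \<open>t = 0\<close>, and \<open>corr\<close> is made for that case. For other \<open>t\<close>
  its term vanishes and the first two terms cancel or vanish themselves.\<close>

lemma coord_val_basis_neg:
  "coord_val (\<lambda>n. dilate_val j (n + int j)) n = (if n = - int j then 1 else 0)"
proof (cases "n > 0")
  case False
  then have "n + int j < 2 ^ j"
    using less_two_power_int[of j] by linarith
  then have "dilate_val j (n + int j) = 0" if "n \<noteq> - int j"
    using that dilate_val_between[of "n + int j" j]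
      dilate_val_neg[of "n + int j" j] by (cases "n + int j" "0::int" rule: linorder_cases) auto
  then show ?thesis
    using False by (auto simp: coord_val_def)
next
  case True
  define a where "a = floor_log (nat n)"
  define t where "t = n + int j - 2 * 2 ^ a"
  have a: "2 ^ a \<le> n" "n < 2 * 2 ^ a"
    unfolding a_def using floor_log_int[OF True] by auto
  have coord_val: "coord_val (\<lambda>n. dilate_val j (n + int j)) n =
      dilate_val j (t + 2 * 2 ^ a) - q * dilate_val j (t + 2 ^ a) - corr n * dilate_val j t"
    using True by (simp add: coord_val_def Let_def a_def[symmetric] t_def algebra_simps)
  have corr: "corr n = (if int j \<le> t + int a then q - q\<^sup>2 else if int j = t + int a + 1 then q else 0)"
    by (simp add: corr_def Let_def a_def[symmetric] t_def algebra_simps)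
  have t: "t < int j" "int j \<le> t + 2 ^ a"
    using a by (auto simp: t_def)
  have j: "int j < 2 ^ j"
    by (rule less_two_power_int)
  have "dilate_val j (t + 2 * 2 ^ a) - q * dilate_val j (t + 2 ^ a) - corr n * dilate_val j t = 0"
  proof (cases "j \<le> a")
    case le: True
    then have le': "j \<le> Suc a" by simp
    show ?thesis
    proof (cases t "0::int" rule: linorder_cases)
      case less
      then show ?thesis
        using dilate_val_add_power[OF le, of "t + 2 ^ a"] t
        by (simp add: dilate_val_neg ac_simps)
    next
      case equal
      have "corr n = q - q\<^sup>2"
        using le by (simp add: corr equal)
      moreover have "dilate_val j (2 * 2 ^ a) = q" "dilate_val j (2 ^ a) = q"
        using dilate_val_add_power[OF le', of 0] dilate_val_add_power[OF le, of 0] by simp_all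
      ultimately show ?thesis
        by (simp add: equal power2_eq_square)
    next
      case greater
      then have "t < 2 ^ j"
        using t j by linarith
      then show ?thesis
        using dilate_val_add_power_between(1)[OF le greater] dilate_val_add_power_between(1)[OF le' greater]
          dilate_val_between[OF greater] by simp
    qed
  next
    case False
    \<comment> \<open>For \<open>j = a + 1\<close> the number \<open>2 * 2 ^ a\<close> is still a
      multiple of \<open>2 ^ j\<close> while \<open>2 ^ a\<close> is not; for larger
      \<open>j\<close> neither is.\<close>
    then have "Suc a = j \<or> Suc (Suc a) \<le> j" by linarith
    then show ?thesis
    proof
      assume eq: "Suc a = j"
      have pow: "(2::int) ^ j = 2 * 2 ^ a" "int j = int a + 1"
        by (simp_all flip: eq)
      have "int j \<le> 2 ^ a"
        using less_two_power_int[of a] pow by linarith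
      then have "dilate_val j (t + 2 ^ a) = 0"
        using t pow by (intro dilate_val_between) linarith+
      moreover have "dilate_val j (t + 2 * 2 ^ a) = corr n * dilate_val j t"
      proof (cases t "0::int" rule: linorder_cases)
        case less
        then have "dilate_val j (t + 2 * 2 ^ a) = 0"
          using t pow by (intro dilate_val_between) linarith+
        then show ?thesis
          using less by (simp add: dilate_val_neg)
      next
        case equal
        then show ?thesis
          using dilate_val_add_power[of j j 0] pow by (simp add: corr)
      next
        case greater
        then have "t < 2 ^ j"
          using t j by linarith
        then show ?thesis
          using dilate_val_add_power_between(1)[OF order_refl greater] dilate_val_between[OF greater]
          by (simp flip: pow(1))
      qed
      ultimately show ?thesis
        by simp
    next
      assume le: "Suc (Suc a) \<le> j"
      \<comment> \<open>Splitting \<open>2 ^ j\<close> into two copies of \<open>2 ^ i\<close>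
        leaves one to dominate \<open>t\<close> and one to dominate
        \<open>2 * 2 ^ a\<close>.\<close>
      define i where "i = j - 1"
      have i: "j = Suc i" "Suc a \<le> i"
        using le by (auto simp: i_def)
      have "(2::int) ^ Suc a \<le> 2 ^ i"
        using i by (intro power_increasing) auto
      then have "t + 2 * 2 ^ a < 2 ^ j"
        using t less_two_power_int[of i] unfolding i(1) power_Suc of_nat_Suc by linarith
      moreover have "0 < t + 2 ^ a"
        using t le by linarith
      moreover have "(0::int) < 2 ^ a"
        by simp
      ultimately have "dilate_val j (t + 2 * 2 ^ a) = 0" "dilate_val j (t + 2 ^ a) = 0"
        by (intro dilate_val_between; linarith)+
      moreover have "corr n * dilate_val j t = 0"
      proof (cases t "0::int" rule: linorder_cases)
        case greater
        then have "t < 2 ^ j"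
          using t j by linarith
        then show ?thesis
          using dilate_val_between[OF greater] by simp
      qed (use le in \<open>auto simp: corr dilate_val_neg\<close>)
      ultimately show ?thesis
        by simp
    qed
  qed
  then show ?thesis
    using True by (simp add: coord_val)
qed

section \<open>The coordinate map is bounded and bounded below\<close>

lemma norm_corr: "norm (corr n) \<le> 2"
proof -
  have "norm (q - q\<^sup>2) \<le> norm q + norm (q\<^sup>2)"
    by (rule norm_triangle_ineq4)
  also have "\<dots> \<le> 1 + 1"
    using norm_q by (intro add_mono) (auto simp: norm_power power_le_one)
  finally show ?thesis
    using norm_q by (auto simp: corr_def Let_def)
qed

lemma norm_coord_val_le:
  assumes "\<And>n. norm (x n) \<le> b"
  shows "norm (coord_val x n) \<le> 4 * b"
proof (cases "n \<le> 0")
  case True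
  then have "norm (coord_val x n) \<le> b"
    using assms by (simp add: coord_val_def)
  then show ?thesis
    using norm_ge_zero[of "coord_val x n"] by linarith
next
  case False
  define a where "a = floor_log (nat n)"
  have b: "b \<ge> 0"
    using assms[of 0] norm_ge_zero order_trans by blast
  have "norm (q * x (n - 2 ^ a)) \<le> 1 * b"
    unfolding norm_mult using norm_q b assms by (intro mult_mono) auto
  moreover have "norm (corr n * x (n - 2 * 2 ^ a)) \<le> 2 * b"
    unfolding norm_mult using norm_corr b assms by (intro mult_mono) auto
  moreover have "coord_val x n = x n - q * x (n - 2 ^ a) - corr n * x (n - 2 * 2 ^ a)"
    using False by (simp add: coord_val_def a_def Let_def)
  moreover have "norm (x n - y - z) \<le> norm (x n) + norm y + norm z" for y z
    using norm_triangle_ineq4[of "x n - y" z] norm_triangle_ineq4[of "x n" y] by linarith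
  ultimately show ?thesis
    using assms[of n] by (smt (verit, best))
qed

text \<open>Solve the definition of \<open>coord_val\<close> for \<open>x n\<close>. The second
  correction looks at negative points, where \<open>x\<close> is bounded by \<open>b\<close>, so
  only the term with \<open>q\<close> feeds back into the recursion; the constant solves
  \<open>K = norm q * K + 3\<close>.\<close>

lemma norm_le_coord_val:
  assumes b: "\<And>n. norm (coord_val x n) \<le> b"
  shows "norm (x n) \<le> 3 / (1 - norm q) * b"
proof -
  let ?K = "3 / (1 - norm q)"
  have b0: "b \<ge> 0"
    using b[of 0] norm_ge_zero order_trans by blast
  have K: "norm q * ?K + 3 = ?K" "1 \<le> ?K"
    using norm_q norm_ge_zero[of q] by (simp_all add: field_simps)
  have nonpos: "norm (x n) \<le> b" if "n \<le> 0" for n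
    using b[of n] that by (simp add: coord_val_def)
  show ?thesis
  proof (induction "nat n" arbitrary: n rule: less_induct)
    case less
    show ?case
    proof (cases "n \<le> 0")
      case True
      have "norm (x n) \<le> 1 * b"
        using nonpos[OF True] by simp
      also have "\<dots> \<le> ?K * b"
        using K b0 by (intro mult_right_mono)
      finally show ?thesis .
    next
      case False
      define a where "a = floor_log (nat n)"
      have a: "2 ^ a \<le> n" "n < 2 * 2 ^ a" "(0::int) < 2 ^ a"
        unfolding a_def using floor_log_int[of n] False by auto
      have "norm (x (n - 2 ^ a)) \<le> ?K * b"
        by (rule less) (use a in auto)
      then have "norm (q * x (n - 2 ^ a)) \<le> norm q * (?K * b)"
        unfolding norm_mult by (intro mult_left_mono) auto
      moreover have "norm (corr n * x (n - 2 * 2 ^ a)) \<le> 2 * b"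
        unfolding norm_mult using norm_corr b0 nonpos a by (intro mult_mono) auto
      moreover have "x n = coord_val x n + q * x (n - 2 ^ a) + corr n * x (n - 2 * 2 ^ a)"
        using False by (simp add: coord_val_def a_def Let_def)
      then have "norm (x n) \<le> norm (coord_val x n) + norm (q * x (n - 2 ^ a)) + norm (corr n * x (n - 2 * 2 ^ a))"
        by (metis add_right_mono norm_triangle_ineq norm_triangle_le)
      ultimately have "norm (x n) \<le> b + norm q * (?K * b) + 2 * b"
        using b[of n] by linarith
      also have "\<dots> = (norm q * ?K + 3) * b"
        by (simp only: distrib_right mult.assoc)
      finally show ?thesis
        by (simp only: K)
    qed
  qed
qed

text \<open>The integers are enumerated by \<open>int_decode\<close> because \<open>c0_space\<close>
  consists of sequences indexed by \<open>nat\<close>.\<close>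

definition coord_map :: "(int \<Rightarrow>\<^sub>C complex) \<Rightarrow> nat \<Rightarrow>\<^sub>C complex"
  where "coord_map x = Bcontfun (\<lambda>k. coord_val (apply_bcontfun x) (int_decode k))"

lemma apply_coord_map: "apply_bcontfun (coord_map x) k = coord_val (apply_bcontfun x) (int_decode k)"
proof -
  have "norm (coord_val (apply_bcontfun x) (int_decode k)) \<le> 4 * norm x" for k
    by (intro norm_coord_val_le norm_bounded)
  then have "(\<lambda>k. coord_val (apply_bcontfun x) (int_decode k)) \<in> bcontfun"
    by (intro bcontfun_normI) (auto simp: continuous_on_discrete)
  then show ?thesis
    by (simp add: coord_map_def Bcontfun_inverse)
qed

lemma isomorphic_F_space_c0: "isomorphic_spaces (F_space lam) c0_space"
proof -
  have "isomorphic_spaces (closure (cspan (range (\<lambda>k. basis (int_decode k))))) c0_space"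
  proof (rule isomorphic_c0I[OF complete_bcontfun])
    show "clinear_on UNIV coord_map"
      unfolding clinear_on_def
      by (auto intro!: bcontfun_eqI simp: apply_coord_map coord_val_def Let_def algebra_simps scaleC_complex_def)
    show "norm (coord_map x) \<le> 4 * norm x" for x
      by (intro norm_bound) (simp add: apply_coord_map norm_coord_val_le norm_bounded)
    show "norm x \<le> 3 / (1 - norm q) * norm (coord_map x)" for x
    proof (intro norm_bound norm_le_coord_val)
      fix n
      show "norm (coord_val (apply_bcontfun x) n) \<le> norm (coord_map x)"
        using norm_bounded[of "coord_map x" "int_encode n"] by (simp add: apply_coord_map)
    qed
    show "coord_map (basis (int_decode k)) = unit_vec k" for k
    proof (rule bcontfun_eqI)
      fix i
      have "coord_val (apply_bcontfun (basis m)) n = (if n = m then 1 else 0)" for m n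
        using coord_val_basis_nonneg[of m n] coord_val_basis_neg[of "nat (- m)" n]
        by (cases "m \<ge> 0") (auto simp: basis_def apply_dilate[abs_def] level_def)
      then show "apply_bcontfun (coord_map (basis (int_decode k))) i = apply_bcontfun (unit_vec k) i"
        by (simp add: apply_coord_map apply_unit_vec) (metis int_decode_inverse)
    qed
  qed
  moreover have "range (\<lambda>k. basis (int_decode k)) = range basis"
    by (metis surj_int_decode image_image)
  ultimately show ?thesis
    by (simp add: F_space_eq span_basis_def)
qed

lemma subspace_F_space: "complex_vector.subspace (F_space lam)"
  unfolding F_space_def by (intro subspace_closure complex_vector.subspace_span)

end

theorem theorem3p8:
  fixes lam :: complex
  assumes "norm lam > 1"
  shows "szlenk_index (F_space lam) = ord_omega \<and> isomorphic_spaces (F_space lam) c0_space"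
proof -
  interpret F_basis lam
    using assms by unfold_locales
  show ?thesis
    using isomorphic_F_space_c0 szlenk_index_c0_isomorphic[OF subspace_F_space] by blast
qed

end
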